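(* (1) The function $\lambda^*$ satisfies the following singular differential equation $$\frac{d\lambda^*}{d\xi}=\frac{\xi}{2\lambda^*}+\frac{\lambda^*}{\xi}+\frac1\xi,$$ whose implicit solution is $e^{-z^2}\xi=-2\int e^{-z^2}dz$, $z=\frac{\lambda^*}{\xi}+\frac1\xi$. If the initial condition $\lambda^*(0)=0$ is imposed, then the solution $\lambda^*(\cdot)$ is real and its implicit formula is given by $$e^{-(\frac{\lambda^*}{\xi}+\frac1\xi)^2}=\frac2\xi\int_{\frac{\lambda^*}{\xi}+\frac1\xi}^{\infty}e^{-t^2}dt\ \ (\xi>0),\qquad e^{-(\frac{\lambda^*}{\xi}+\frac1\xi)^2}=-\frac2\xi\int_{-\infty}^{\frac{\lambda^*}{\xi}+\frac1\xi}e^{-t^2}dt\ \ (\xi<0),\qquad\lambda^*(0)=0,$$ or, $e^{-(\frac{\lambda^*}{\xi}+\frac1\xi)^2}=\frac{\sqrt\pi}{\xi}\big[\mathrm{sgn}\,\xi-\mathrm{erf}\big(\frac{\lambda^*}{\xi}+\frac1\xi\big)\big]$ for $\xi\neq0$, $\lambda^*(0)=0$. Also, $\lambda^*(\cdot)$ has the following series representation near $\xi=0$: $$\lambda^*(\xi)=\sum_{j=1}^\infty a_{2j}\xi^{2j},\qquad a_2=-\frac12,\qquad a_{2j}=\sum_{r=1}^{j-1}(2r-1)a_{2r}a_{2(j-r)},\ j\ge2.$$ (2) Moreover, if $\lambda$ is real and $\xi=\pm\sqrt\tau$, then $\omega$, as a function of $(\lambda,\tau)$, satisfies the heat equation with the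 imposed initial condition $$\partial_\tau\omega=-\tfrac14\,\partial_{\lambda\lambda}\omega,\qquad\omega(\lambda,0)=1-\frac{1}{1+\lambda},\quad\lambda>-1.$$ (3) Let $\lambda$ be a real fixed value, that is, $\omega(\lambda,\xi)=1-\int_{\mathbb{R}}\frac{w(v)\,dv}{iv\xi+1+\lambda}=1-\int_{\mathbb{R}}\frac{(1+\lambda)w(v)\,dv}{(1+\lambda)^2+(v\xi)^2}$. Then $\omega$ satisfies the differential equation $$\frac{d\omega}{d\xi}+\Big(\frac1\xi+\frac{2(1+\lambda)^2}{\xi^3}\Big)\omega=\frac1\xi+\frac{2\lambda(1+\lambda)}{\xi^3},$$ whose solution is $\omega=\frac{e^{(1+\lambda)^2/\xi^2}}{\xi}\int e^{-(1+\lambda)^2/\tilde\xi^2}\big(1+\frac{2\lambda(1+\lambda)}{\tilde\xi^2}\big)d\tilde\xi$. If the initial condition $\omega(\lambda,0)=1-\frac1{1+\lambda}$, $\lambda>-1$, is imposed, then the solution is $$\omega=\frac{e^{(1+\lambda)^2/\xi^2}}{\xi}\int_0^\xi e^{-(1+\lambda)^2/\tilde\xi^2}\Big(1+\frac{2\lambda(1+\lambda)}{\tilde\xi^2}\Big)d\tilde\xi,$$ which (through $\omega(\lambda^*(\xi),\xi)=0$) also implies the implicit formulas for $\lambda^*$ in (1).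
   Context: $w(v)=e^{-v^2}/\sqrt\pi$. $\omega(\lambda,\xi)=1-\int_{\mathbb{R}}\frac{w(v)\,dv}{iv\xi+1+\lambda}$, for $\xi\in\mathbb{R}$ and $\mathrm{Re}\,\lambda\neq-1$. For $\xi\in(-\sqrt\pi,\sqrt\pi)$, $\lambda^*(\xi)$ denotes the unique $\lambda\in(-1,0]$ with $\omega(\lambda,\xi)=0$. $\mathrm{erf}(z)=\frac{2}{\sqrt\pi}\int_0^ze^{-t^2}dt$. Integrals without limits are indefinite integrals.
   Formalization: The series for λ* diverges at every ξ≠0, since |a_{2j}| ≥ (2j−3)/2·|a_{2j−2}|, so the equality λ*(ξ)=Σ a_{2j}ξ^{2j} is replaced by an asymptotic expansion: for every N, λ*(ξ)−Σ_{j≤N} a_{2j}ξ^{2j} = O(ξ^{2N+2}) as ξ→0. *)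

theory Defs
  imports "HOL-Analysis.Analysis" "HOL-Library.Landau_Symbols"
begin

definition w :: "real \<Rightarrow> real" where
  "w v = exp (- v\<^sup>2) / sqrt pi"

(* Meaningful for Re l \<noteq> -1 only, where the integrand is bounded by a multiple of w. *)
definition omega :: "complex \<Rightarrow> real \<Rightarrow> complex" where
  "omega l x = 1 - (LBINT v. complex_of_real (w v) / (\<i> * of_real v * of_real x + 1 + l))"

(* Meaningful for \<bar>x\<bar> < sqrt pi only, where there is exactly one such l. *)
definition lambda_star :: "real \<Rightarrow> real" where
  "lambda_star x = (THE l. -1 < l \<and> l \<le> 0 \<and> omega (complex_of_real l) x = 0)"

(* The ereal endpoints make this an oriented integral, so that z < 0 is covered. *)
definition erf :: "real \<Rightarrow> real" where
  "erf z = 2 / sqrt pi * (LBINT t=0..ereal z. exp (- t\<^sup>2))"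

(* The substitution variable z = lambda / xi + 1 / xi; 'a is real or complex. *)
definition zvar :: "'a::real_normed_field \<Rightarrow> real \<Rightarrow> 'a" where
  "zvar l x = l / of_real x + 1 / of_real x"

(* The equation is singular at x = 0 and where f x = 0. Both are excluded explicitly,
   because division by zero yields 0 in HOL. *)
definition solves_lambda_ode :: "(real \<Rightarrow> 'a::real_normed_field) \<Rightarrow> real set \<Rightarrow> bool" where
  "solves_lambda_ode f S \<longleftrightarrow>
     (\<forall>x\<in>S. x \<noteq> 0 \<and> f x \<noteq> 0 \<and>
        (f has_vector_derivative (of_real x / (2 * f x) + f x / of_real x + 1 / of_real x)) (at x))"

definition implicit_formula :: "real \<Rightarrow> real \<Rightarrow> bool" where
  "implicit_formula l x \<longleftrightarrow>
     (x > 0 \<longrightarrow> exp (- (zvar l x)\<^sup>2) = 2 / x * (LBINT t:{zvar l x..}. exp (- t\<^sup>2))) \<and>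
     (x < 0 \<longrightarrow> exp (- (zvar l x)\<^sup>2) = - (2 / x) * (LBINT t:{..zvar l x}. exp (- t\<^sup>2))) \<and>
     (x = 0 \<longrightarrow> l = 0)"

definition implicit_formula_erf :: "real \<Rightarrow> real \<Rightarrow> bool" where
  "implicit_formula_erf l x \<longleftrightarrow>
     (x \<noteq> 0 \<longrightarrow> exp (- (zvar l x)\<^sup>2) = sqrt pi / x * (sgn x - erf (zvar l x))) \<and>
     (x = 0 \<longrightarrow> l = 0)"

(* Series representation near 0 in the sense of Poincare. For the coefficients of lambda_star,
   \<bar>a (2 j)\<bar> \<ge> (2 j - 3) / 2 * \<bar>a (2 (j - 1))\<bar>, so the series diverges at every x \<noteq> 0 and a
   representation by its sum is impossible. *)
definition even_series_near_0 :: "(real \<Rightarrow> real) \<Rightarrow> (nat \<Rightarrow> real) \<Rightarrow> bool" where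
  "even_series_near_0 f a \<longleftrightarrow>
     (\<forall>N. (\<lambda>x. f x - (\<Sum>j=1..N. a (2*j) * x ^ (2*j))) \<in> O[at 0](\<lambda>x. x ^ (2*N + 2)))"

definition solves_omega_ode :: "real \<Rightarrow> (real \<Rightarrow> complex) \<Rightarrow> real set \<Rightarrow> bool" where
  "solves_omega_ode l y S \<longleftrightarrow>
     (\<forall>x\<in>S. x \<noteq> 0 \<and>
        (\<exists>y'. (y has_vector_derivative y') (at x) \<and>
           y' + of_real (1 / x + 2 * (1 + l)\<^sup>2 / x^3) * y x =
             of_real (1 / x + 2 * l * (1 + l) / x^3)))"

definition omega_integrand :: "real \<Rightarrow> real \<Rightarrow> real" where
  "omega_integrand l s = exp (- ((1 + l)\<^sup>2 / s\<^sup>2)) * (1 + 2 * l * (1 + l) / s\<^sup>2)"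

(* Oriented integral, so that x < 0 is covered. *)
definition omega_formula :: "real \<Rightarrow> real \<Rightarrow> real" where
  "omega_formula l x =
     exp ((1 + l)\<^sup>2 / x\<^sup>2) / x * (LBINT s=0..ereal x. omega_integrand l s)"

end

theory Submission
  imports Defs "HOL-Probability.Distributions" "HOL-Complex_Analysis.Cauchy_Integral_Theorem"
    "HOL-Real_Asymp.Real_Asymp"
begin

text \<open>
  Write \<open>a = 1 + \<lambda>\<close> and \<open>z = (1 + \<lambda>) / x\<close>, and let \<open>T z\<close> be the Gaussian tail, the integral of
  \<open>exp (- t\<^sup>2)\<close> over \<open>{z..}\<close>. The argument rests on one function,
  \<open>defect x \<lambda> = x * exp (- z\<^sup>2) - 2 * T z\<close>, a first integral of the equation for \<open>\<lambda>\<^sup>*\<close>. Along any curve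
  \<open>\<lambda> = u x\<close> its derivative is a positive multiple of \<open>x\<^sup>2 + 2 u + 2 u\<^sup>2 - 2 x u u'\<close>
  (\<open>defect_deriv\<close>), and it tends to \<open>0\<close> as \<open>x\<close> decreases to \<open>0\<close> if \<open>u\<close> tends to a limit above \<open>-1\<close>
  (\<open>defect_tendsto\<close>). For
  \<open>x > 0\<close> both implicit formulas say \<open>defect x \<lambda> = 0\<close>. The defect increases in \<open>\<lambda>\<close> up to
  \<open>\<lambda> = 0\<close> and is positive from there on by Mills' inequality \<open>2 z T z < exp (- z\<^sup>2)\<close>. So it has at most
  one root, which exists and lies in \<open>]-1, 0[\<close> when \<open>x < sqrt pi\<close>, and its sign tells on which side of
  the root \<open>\<lambda>\<close> lies (\<open>defect_root\<close>, \<open>defect_sign\<close>). Negative \<open>x\<close> are always reduced to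
  positive ones by reflection.

  The symmetry of \<open>w\<close> gives \<open>\<omega>(\<lambda>, x) = 1 - \<kappa>(a, x\<^sup>2)\<close>, where \<open>\<kappa>(a, t)\<close> is the integral of
  \<open>a w(v) / (a\<^sup>2 + v\<^sup>2 t)\<close>. Differentiating under the integral sign and integrating by parts
  with \<open>w' v = - 2 v w v\<close> yields the heat equation (\<open>kappa_heat\<close>) and the equation in \<open>x\<close>
  (\<open>kappa_ode\<close>). The integrating factor \<open>x * exp (- (a / x)\<^sup>2)\<close> vanishes at \<open>0\<close>, so a solution of the
  latter that is continuous at \<open>0\<close> is unique (\<open>omega_ode_unique\<close>) and is given by the integral formula.
  Constant curves \<open>u = \<lambda>\<close> in \<open>defect_deriv\<close> show that the integral in that formula is
  \<open>defect x \<lambda>\<close> for \<open>x > 0\<close>. Hence the zeros of \<open>\<omega>\<close> are the zeros of the defect. As \<open>\<lambda>\<^sup>*\<close> is thereby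
  described through the inverse of \<open>z \<mapsto> 2 T z exp (z\<^sup>2)\<close>, it is differentiable and solves its equation.

  For a complex solution \<open>f\<close> tending to \<open>0\<close>, \<open>(Im f / x)\<^sup>2\<close> decreases in \<open>x\<close>. If it were nonzero
  somewhere, then \<open>\<bar>f\<bar>\<close> would be at least a multiple of \<open>x\<close> near \<open>0\<close>, which makes the derivative of
  \<open>Re f\<close> at least \<open>1 / (2 x)\<close> there, and \<open>Re f\<close> would be unbounded (\<open>lambda_ode_solution_real\<close>). So
  \<open>f\<close> is real; its defect is constant with limit \<open>0\<close>, and \<open>f = \<lambda>\<^sup>*\<close>.

  For the series, perturb the coefficient of \<open>x^(2 n)\<close> in the formal solution, truncated after that term, by
  \<open>\<plusminus>1\<close>. The derivative of its defect then has the sign of the perturbation near \<open>0\<close>, so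
  the two perturbed polynomials enclose \<open>\<lambda>\<^sup>*\<close> (\<open>lambda_star_expansion\<close>).
\<close>

section \<open>The Gaussian tail\<close>

lemma gauss_even_moment:
  "has_bochner_integral lborel (\<lambda>v::real. exp (- v\<^sup>2) * v ^ (2 * k)) (sqrt pi * (fact (2 * k) / (2 ^ (2 * k) * fact k)))"
  using has_bochner_integral_even_function[OF gaussian_moment_even_pos[where k=k]] by simp

lemma gauss_integrable: "integrable lborel (\<lambda>v::real. exp (- v\<^sup>2))"
  using gauss_even_moment[of 0] by (simp add: has_bochner_integral_iff)

lemma gauss_set_integrable: "A \<in> sets lborel \<Longrightarrow> set_integrable lborel A (\<lambda>v::real. exp (- v\<^sup>2))"
  unfolding set_integrable_def using integrable_mult_indicator[OF _ gauss_integrable, of A] by simp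

lemma w_integrable: "integrable lborel w" and w_integral: "(LBINT v. w v) = 1"
  using gauss_even_moment[of 0] by (simp_all add: w_def[abs_def] has_bochner_integral_iff)

lemma w_second_moment_integrable: "integrable lborel (\<lambda>v. v\<^sup>2 * w v)"
proof -
  have "integrable lborel (\<lambda>v. (exp (- v\<^sup>2) * v ^ 2) * (1 / sqrt pi))"
    using gauss_even_moment[of 1] by (intro integrable_mult_left) (simp add: has_bochner_integral_iff)
  then show ?thesis by (simp add: w_def mult_ac)
qed

text \<open>The integral of \<open>exp (- t\<^sup>2)\<close> over the half-line to the right of \<open>z\<close>.\<close>

definition gauss_tail :: "real \<Rightarrow> real" where
  "gauss_tail z = (LBINT t:{z..}. exp (- t\<^sup>2))"

lemma gauss_tail_0: "gauss_tail 0 = sqrt pi / 2"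
  using gaussian_moment_0 by (simp add: gauss_tail_def set_lebesgue_integral_def has_bochner_integral_iff)

lemma left_gauss_tail: "(LBINT t:{..z}. exp (- t\<^sup>2)) = gauss_tail (- z)"
  unfolding gauss_tail_def
  by (subst set_integral_reflect) (simp add: atLeast_def le_minus_iff minus_le_iff)

lemma gauss_tail_eq_interval: "gauss_tail z = (LBINT t=ereal z..\<infinity>. exp (- t\<^sup>2))"
  unfolding interval_integral_to_infinity_eq gauss_tail_def
proof (rule set_integral_cong_set)
  show "set_borel_measurable lborel {z..} (\<lambda>x. exp (- x\<^sup>2))" "set_borel_measurable lborel {z<..} (\<lambda>x. exp (- x\<^sup>2))"
    by (auto simp: set_borel_measurable_def)
  show "AE x in lborel. (x \<in> {z<..}) = (x \<in> {z..})"
    by (rule AE_I'[of "{z}"]) auto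
qed

lemma gauss_interval_integrable: "interval_lebesgue_integrable lborel a b (\<lambda>t. exp (- t\<^sup>2))"
  unfolding interval_lebesgue_integrable_def by (auto intro: gauss_set_integrable)

lemma gauss_tail_split:
  "(LBINT t=ereal a..ereal z. exp (- t\<^sup>2)) + gauss_tail z = gauss_tail a"
  unfolding gauss_tail_eq_interval by (rule interval_integral_sum[OF gauss_interval_integrable])

lemma gauss_tail_erf: "gauss_tail z = sqrt pi / 2 * (1 - erf z)"
proof -
  have "sqrt pi / 2 * erf z = (LBINT t=0..ereal z. exp (- t\<^sup>2))"
    by (simp add: erf_def)
  then show ?thesis
    using gauss_tail_split[of 0 z] gauss_tail_0 by (simp add: algebra_simps zero_ereal_def)
qed

lemma erf_minus: "erf (- z) = - erf z"
proof -
  have "(LBINT t=0..ereal (- z). exp (- t\<^sup>2)) = (LBINT t=ereal z..0. exp (- t\<^sup>2))"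
    by (subst interval_integral_reflect) simp
  then show ?thesis
    by (simp add: erf_def interval_integral_endpoints_reverse[of "ereal z" 0])
qed

lemma gauss_tail_deriv [derivative_intros]:
  assumes "(g has_real_derivative g') (at x within S)"
  shows "((\<lambda>x. gauss_tail (g x)) has_real_derivative - exp (- (g x)\<^sup>2) * g') (at x within S)"
proof -
  have tail: "(gauss_tail has_real_derivative - exp (- z\<^sup>2)) (at z)" for z
  proof -
    let ?F = "\<lambda>u. LBINT t=ereal (z - 1)..ereal u. exp (- t\<^sup>2)"
    have "(?F has_vector_derivative exp (- z\<^sup>2)) (at z within {z - 1..z + 1})"
      by (intro interval_integral_FTC2 continuous_intros) auto
    then have "(?F has_real_derivative exp (- z\<^sup>2)) (at z)"
      by (subst (asm) at_within_interior) (auto simp: has_real_derivative_iff_has_vector_derivative)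
    then have "((\<lambda>u. gauss_tail (z - 1) - ?F u) has_real_derivative - exp (- z\<^sup>2)) (at z)"
      by (auto intro!: derivative_eq_intros)
    moreover have "(\<lambda>u. gauss_tail (z - 1) - ?F u) = gauss_tail"
      using gauss_tail_split[of "z - 1"] by (auto simp: fun_eq_iff algebra_simps)
    ultimately show ?thesis by simp
  qed
  show ?thesis using DERIV_chain2[OF tail assms] by simp
qed

lemma gauss_tail_nonneg: "0 \<le> gauss_tail z"
  unfolding gauss_tail_def set_lebesgue_integral_def by (rule integral_nonneg_AE) auto

lemma gauss_tail_tendsto: "(gauss_tail \<longlongrightarrow> 0) at_top"
proof -
  have "((\<lambda>z. LBINT t:{0..z}. exp (- t\<^sup>2)) \<longlongrightarrow> gauss_tail 0) at_top"
    unfolding gauss_tail_def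
    by (intro tendsto_set_lebesgue_integral_at_top gauss_set_integrable) auto
  then have "((\<lambda>z. gauss_tail 0 - (LBINT t:{0..z}. exp (- t\<^sup>2))) \<longlongrightarrow> gauss_tail 0 - gauss_tail 0) at_top"
    by (intro tendsto_intros)
  moreover have "\<forall>\<^sub>F z in at_top. gauss_tail 0 - (LBINT t:{0..z}. exp (- t\<^sup>2)) = gauss_tail z"
    using eventually_ge_at_top[of 0]
  proof eventually_elim
    case (elim z)
    then show ?case
      using gauss_tail_split[of 0 z] by (simp add: interval_integral_Icc)
  qed
  ultimately show ?thesis using tendsto_cong by force
qed

lemma pos_of_decreasing_to_0:
  fixes f :: "real \<Rightarrow> real"
  assumes der: "\<And>t. z \<le> t \<Longrightarrow> (f has_real_derivative f' t) (at t)" and neg: "\<And>t. z \<le> t \<Longrightarrow> f' t < 0"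
    and lim: "(f \<longlongrightarrow> 0) at_top"
  shows "0 < f z"
proof -
  have mono: "f t < f s" if "z \<le> s" "s < t" for s t
    by (rule DERIV_neg_imp_decreasing[OF that(2)]) (use that der neg order_trans in blast)
  have "f t \<le> f (z + 1)" if "z + 1 \<le> t" for t
    using mono[of "z + 1" t] that by (cases "t = z + 1") auto
  then have "0 \<le> f (z + 1)"
    by (intro tendsto_upperbound[OF lim]) (auto simp: eventually_at_top_linorder)
  with mono[of z "z + 1"] show ?thesis by simp
qed

text \<open>The difference of the two sides, divided by \<open>2 * z\<close>, is decreasing and tends to \<open>0\<close>.\<close>

lemma mills_ratio_bound:
  assumes "0 < z"
  shows "2 * z * gauss_tail z < exp (- z\<^sup>2)"
proof -
  let ?f = "\<lambda>t. exp (- t\<^sup>2) / (2 * t) - gauss_tail t"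
  have "0 < ?f z"
  proof (rule pos_of_decreasing_to_0[where f = ?f and f' = "\<lambda>t. - exp (- t\<^sup>2) / (2 * t\<^sup>2)"])
    fix t assume t: "z \<le> t"
    then have "0 < t" using assms by simp
    then show "(?f has_real_derivative - exp (- t\<^sup>2) / (2 * t\<^sup>2)) (at t)"
      by (auto intro!: derivative_eq_intros) (simp add: field_simps power2_eq_square)
    show "- exp (- t\<^sup>2) / (2 * t\<^sup>2) < 0"
      using \<open>0 < t\<close> by simp
  next
    have "((\<lambda>t::real. exp (- t\<^sup>2) / (2 * t)) \<longlongrightarrow> 0) at_top" by real_asymp
    from tendsto_diff[OF this gauss_tail_tendsto] show "(?f \<longlongrightarrow> 0) at_top" by simp
  qed
  then show ?thesis using assms by (simp add: field_simps)
qed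

section \<open>The first integral of the equation for \<open>\<lambda>\<close>\<close>

text \<open>The first integral. Its vanishing is the implicit formula for positive \<open>x\<close>; negative \<open>x\<close> are
  reached through \<open>\<bar>x\<bar>\<close>.\<close>

definition defect :: "real \<Rightarrow> real \<Rightarrow> real" where
  "defect x l = x * exp (- (zvar l x)\<^sup>2) - 2 * gauss_tail (zvar l x)"

lemma zvar_real: "zvar l x = (1 + l) / x"
  for l :: real
  by (simp add: zvar_def add_divide_distrib)

text \<open>The common chain rule behind the derivatives of the defect in \<open>x\<close> and in \<open>\<lambda>\<close>.\<close>

lemma first_integral_deriv:
  assumes "(f has_real_derivative f') (at x)" "(z has_real_derivative z') (at x)"
  shows "((\<lambda>x. f x * exp (- (z x)\<^sup>2) - 2 * gauss_tail (z x)) has_real_derivative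
     exp (- (z x)\<^sup>2) * (f' - 2 * z' * (f x * z x - 1))) (at x)"
  using assms by (auto intro!: derivative_eq_intros simp: algebra_simps)

text \<open>The factor \<open>x\<^sup>2 + 2 u + 2 u\<^sup>2 - 2 x u u'\<close> vanishes, for \<open>u \<noteq> 0\<close>, exactly when
  \<open>u\<close> satisfies the equation for \<open>\<lambda>\<^sup>*\<close>.\<close>

lemma defect_deriv:
  assumes "0 < x" "(u has_real_derivative u') (at x)"
  shows "((\<lambda>x. defect x (u x)) has_real_derivative
     exp (- (zvar (u x) x)\<^sup>2) * (x\<^sup>2 + 2 * u x + 2 * (u x)\<^sup>2 - 2 * x * u x * u') / x\<^sup>2) (at x)"
proof -
  have "((\<lambda>x. (1 + u x) / x) has_real_derivative (u' * x - (1 + u x)) / x\<^sup>2) (at x)" (is "(?z has_real_derivative ?z') _")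
    using assms by (auto intro!: derivative_eq_intros simp: power2_eq_square)
  from first_integral_deriv[OF DERIV_ident this]
  have "((\<lambda>x. defect x (u x)) has_real_derivative exp (- (zvar (u x) x)\<^sup>2) * (1 - 2 * ?z' * (x * ?z x - 1))) (at x)"
    by (simp add: defect_def zvar_real)
  moreover have "1 - 2 * ?z' * (x * ?z x - 1) = (x\<^sup>2 + 2 * u x + 2 * (u x)\<^sup>2 - 2 * x * u x * u') / x\<^sup>2"
    using assms(1) by (simp add: field_simps power2_eq_square)
  ultimately show ?thesis by simp
qed

lemma defect_tendsto:
  assumes u: "(u \<longlongrightarrow> l) (at_right 0)" and "-1 < l"
  shows "((\<lambda>x. defect x (u x)) \<longlongrightarrow> 0) (at_right 0)"
proof -
  have "filterlim (\<lambda>x. (1 + u x) * inverse x) at_top (at_right 0)"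
    using assms(2)
    by (intro filterlim_tendsto_pos_mult_at_top[of _ "1 + l"] tendsto_intros u filterlim_inverse_at_top_right) auto
  then have z: "filterlim (\<lambda>x. zvar (u x) x) at_top (at_right 0)"
    by (simp add: zvar_real divide_inverse)
  have "((\<lambda>x. x * exp (- (zvar (u x) x)\<^sup>2)) \<longlongrightarrow> 0) (at_right 0)"
  proof (rule Lim_null_comparison)
    show "\<forall>\<^sub>F x in at_right 0. norm (x * exp (- (zvar (u x) x)\<^sup>2)) \<le> \<bar>x\<bar>"
      by (intro always_eventually) (auto simp: abs_mult intro: mult_left_le)
    show "((\<lambda>x::real. \<bar>x\<bar>) \<longlongrightarrow> 0) (at_right 0)"
      by (intro tendsto_rabs_zero tendsto_ident_at)
  qed
  from tendsto_diff[OF this tendsto_mult[OF tendsto_const[of 2] filterlim_compose[OF gauss_tail_tendsto z]]]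
  show ?thesis by (simp add: defect_def)
qed

text \<open>Comparison from the singular point: monotonicity on \<open>]0, r[\<close> together with the limit at \<open>0\<close>.\<close>

lemma nonneg_of_limit_0:
  fixes F :: "real \<Rightarrow> real"
  assumes "\<And>x. 0 < x \<Longrightarrow> x < r \<Longrightarrow> (F has_real_derivative F' x) (at x)"
    and "\<And>x. 0 < x \<Longrightarrow> x < r \<Longrightarrow> 0 \<le> F' x"
    and lim: "(F \<longlongrightarrow> 0) (at_right 0)" and "0 < x" "x < r"
  shows "0 \<le> F x"
proof (rule tendsto_upperbound[OF lim])
  show "\<forall>\<^sub>F y in at_right 0. F y \<le> F x"
    unfolding eventually_at_right_field
  proof (intro exI conjI allI impI)
    fix y assume "0 < y" "y < x"
    then show "F y \<le> F x"
      by (intro DERIV_nonneg_imp_nondecreasing[where f = F] less_imp_le)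
        (auto intro!: exI[of _ "F' _"] assms(1,2) intro: less_le_trans le_less_trans[OF _ assms(5)])
  qed (use \<open>0 < x\<close> in simp)
qed simp

lemma zero_of_limit_0:
  fixes F :: "real \<Rightarrow> 'a::real_normed_vector"
  assumes der: "\<And>x. 0 < x \<Longrightarrow> x < r \<Longrightarrow> (F has_vector_derivative 0) (at x)"
    and lim: "(F \<longlongrightarrow> 0) (at_right 0)" and "0 < x" "x < r"
  shows "F x = 0"
proof -
  obtain c where c: "\<And>y. y \<in> {0<..<r} \<Longrightarrow> F y = c"
    using has_vector_derivative_zero_constant[of "{0<..<r}" F] der
    by (metis convex_real_interval(8) greaterThanLessThan_iff has_vector_derivative_at_within)
  have "\<forall>\<^sub>F y in at_right 0. F y = c"
    unfolding eventually_at_right_field using c assms(3,4) by (intro exI[of _ r]) auto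
  then have "(F \<longlongrightarrow> c) (at_right 0)" by (rule tendsto_eventually)
  then have "c = 0" using lim tendsto_unique trivial_limit_at_right_real by blast
  with c assms(3,4) show ?thesis by simp
qed

lemma defect_deriv_l:
  assumes "x \<noteq> 0"
  shows "((\<lambda>l. defect x l) has_real_derivative - (2 / x * exp (- (zvar l x)\<^sup>2) * l)) (at l)"
proof -
  have "((\<lambda>l. (1 + l) / x) has_real_derivative 1 / x) (at l)"
    using assms by (auto intro!: derivative_eq_intros)
  from first_integral_deriv[OF DERIV_const[of x] this]
  have "((\<lambda>l. defect x l) has_real_derivative exp (- (zvar l x)\<^sup>2) * (0 - 2 * (1 / x) * (x * ((1 + l) / x) - 1))) (at l)"
    by (simp add: defect_def zvar_real)
  moreover have "0 - 2 * (1 / x) * (x * ((1 + l) / x) - 1) = - (2 / x * l)"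
    using assms by (simp add: field_simps)
  ultimately have "((\<lambda>l. defect x l) has_real_derivative exp (- (zvar l x)\<^sup>2) * - (2 / x * l)) (at l)"
    by (simp only:)
  then show ?thesis by (simp add: mult_ac)
qed

text \<open>The derivative in \<open>\<lambda>\<close> has the sign of \<open>- \<lambda>\<close>, so the defect increases up to \<open>\<lambda> = 0\<close> only; to the right of
  \<open>0\<close> positivity comes from Mills' inequality instead.\<close>

lemma defect_strict_mono:
  assumes "0 < x" "l < k" "k \<le> 0"
  shows "defect x l < defect x k"
proof (rule DERIV_pos_imp_increasing_open[OF assms(2)])
  show "continuous_on {l..k} (defect x)"
    using defect_deriv_l[of x] assms(1)
    by (intro continuous_at_imp_continuous_on ballI) (auto intro: DERIV_isCont)
  fix y assume "l < y" "y < k"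
  then have "0 < - (2 / x * exp (- (zvar y x)\<^sup>2) * y)"
    using assms by (simp add: mult_pos_neg divide_neg_pos)
  then show "\<exists>d. (defect x has_real_derivative d) (at y) \<and> 0 < d"
    using defect_deriv_l[of x y] assms(1) by auto
qed

lemma defect_pos:
  assumes "0 < x" "0 \<le> l"
  shows "0 < defect x l"
proof -
  have z: "0 < zvar l x" and xz: "1 \<le> x * zvar l x"
    using assms by (auto simp: zvar_real)
  have "2 * gauss_tail (zvar l x) \<le> (x * zvar l x) * (2 * gauss_tail (zvar l x))"
    using xz gauss_tail_nonneg[of "zvar l x"] by (simp add: mult_le_cancel_right1)
  also have "\<dots> < x * exp (- (zvar l x)\<^sup>2)"
    using mult_strict_left_mono[OF mills_ratio_bound[OF z] assms(1)] by (simp add: mult_ac)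
  finally show ?thesis by (simp add: defect_def)
qed

lemma defect_root:
  assumes "0 < x" "x < sqrt pi"
  obtains l where "-1 < l" "l < 0" "defect x l = 0"
proof -
  have "defect x (-1) < 0" using assms by (simp add: defect_def zvar_real gauss_tail_0)
  moreover have "0 < defect x 0" using assms by (simp add: defect_pos)
  moreover have "continuous_on {-1..0} (defect x)"
    using defect_deriv_l[of x] assms(1)
    by (intro continuous_at_imp_continuous_on ballI) (auto intro: DERIV_isCont)
  ultimately obtain l where "-1 \<le> l" "l \<le> 0" "defect x l = 0"
    using IVT'[of "defect x" "-1" 0 0] by force
  then show ?thesis using that \<open>defect x (-1) < 0\<close> \<open>0 < defect x 0\<close>
    by (metis less_eq_real_def less_irrefl)
qed

lemma defect_sign:
  assumes "0 < x" "defect x l0 = 0"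
  shows "defect x l \<ge> 0 \<longleftrightarrow> l0 \<le> l" "defect x l \<le> 0 \<longleftrightarrow> l \<le> l0" "defect x l = 0 \<longleftrightarrow> l = l0"
proof -
  have neg: "l0 < 0" using assms defect_pos[of x l0] by fastforce
  have lt: "defect x l < 0" if "l < l0"
    using defect_strict_mono[OF assms(1) that] neg assms by simp
  have gt: "defect x l > 0" if "l0 < l"
  proof (cases "l < 0")
    case True
    then show ?thesis using defect_strict_mono[OF assms(1) that] neg assms by simp
  qed (use assms defect_pos in auto)
  show "defect x l \<ge> 0 \<longleftrightarrow> l0 \<le> l" "defect x l \<le> 0 \<longleftrightarrow> l \<le> l0" "defect x l = 0 \<longleftrightarrow> l = l0"
    using lt gt assms(2) by (force simp: not_less linorder_neq_iff)+
qed

lemma implicit_formula_iff_defect: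
  assumes "x \<noteq> 0"
  shows "implicit_formula l x \<longleftrightarrow> defect \<bar>x\<bar> l = 0"
proof (cases "0 < x")
  case True
  then have "exp (- (zvar l x)\<^sup>2) = 2 / x * gauss_tail (zvar l x) \<longleftrightarrow> defect x l = 0"
    by (auto simp: defect_def field_simps)
  with True show ?thesis by (simp add: implicit_formula_def gauss_tail_def)
next
  case False
  with assms have "x < 0" by simp
  then have "exp (- (zvar l x)\<^sup>2) = - (2 / x) * gauss_tail (- zvar l x) \<longleftrightarrow> defect (- x) l = 0"
    by (auto simp: defect_def zvar_real field_simps)
  with \<open>x < 0\<close> show ?thesis by (simp add: implicit_formula_def left_gauss_tail)
qed

lemma implicit_formula_erf_iff_defect:
  assumes "x \<noteq> 0"
  shows "implicit_formula_erf l x \<longleftrightarrow> defect \<bar>x\<bar> l = 0"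
proof (cases "0 < x")
  case True
  then show ?thesis
    by (auto simp: implicit_formula_erf_def defect_def gauss_tail_erf field_simps)
next
  case False
  with assms have "x < 0" by simp
  moreover from this have "zvar l (- x) = - zvar l x" by (simp add: zvar_real)
  ultimately show ?thesis
    by (auto simp: implicit_formula_erf_def defect_def gauss_tail_erf erf_minus field_simps)
qed

section \<open>Integration against the Gaussian weight\<close>

lemma w_borel [measurable]: "w \<in> borel_measurable borel"
  unfolding w_def[abs_def] by measurable

lemma w_nonneg: "0 \<le> w v"
  by (simp add: w_def)

lemma w_minus: "w (- v) = w v"
  by (simp add: w_def)

lemma w_deriv: "(w has_real_derivative - 2 * v * w v) (at v)"
proof -
  have "((\<lambda>v::real. exp (- v\<^sup>2)) has_real_derivative - 2 * v * exp (- v\<^sup>2)) (at v)"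
    by (auto intro!: derivative_eq_intros)
  from DERIV_cdivide[OF this, of "sqrt pi"] show ?thesis by (simp add: w_def[abs_def])
qed

lemma w_bound_integrable:
  assumes [measurable]: "f \<in> borel_measurable borel" and "\<And>v. \<bar>f v\<bar> \<le> B"
  shows "integrable lborel (\<lambda>v. f v * w v)"
proof (rule Bochner_Integration.integrable_bound)
  show "integrable lborel (\<lambda>v. B * w v)" using w_integrable by simp
  show "AE v in lborel. norm (f v * w v) \<le> norm (B * w v)"
    using assms(2) w_nonneg by (auto simp: abs_mult intro!: mult_right_mono order_trans[OF assms(2)])
qed measurable

text \<open>Integration by parts on the whole line with \<open>w' v = - 2 v w v\<close>. The linear bound on \<open>h\<close> removes the
  boundary terms and, with the second moment, makes \<open>v * h v * w v\<close> integrable.\<close>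

lemma w_integral_by_parts:
  assumes der: "\<And>v. (h has_real_derivative h' v) (at v)" and cont: "\<And>v. isCont h' v"
    and h: "\<And>v. \<bar>h v\<bar> \<le> B * \<bar>v\<bar>" and h': "\<And>v. \<bar>h' v\<bar> \<le> C"
  shows "(LBINT v. h' v * w v - 2 * v * h v * w v) = 0"
    and "integrable lborel (\<lambda>v. v * h v * w v)"
proof -
  have hc: "isCont h v" for v using der DERIV_isCont by blast
  have [measurable]: "h \<in> borel_measurable borel" "h' \<in> borel_measurable borel"
    using hc cont by (auto intro!: borel_measurable_continuous_onI continuous_at_imp_continuous_on)
  show i1: "integrable lborel (\<lambda>v. v * h v * w v)"
  proof (rule Bochner_Integration.integrable_bound)
    show "integrable lborel (\<lambda>v. B * (v\<^sup>2 * w v))"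
      by (intro integrable_mult_right w_second_moment_integrable)
    have "norm (v * h v * w v) \<le> norm (B * (v\<^sup>2 * w v))" for v
    proof -
      have "\<bar>v\<bar> * \<bar>h v\<bar> \<le> B * v\<^sup>2"
        using mult_left_mono[OF h[of v], of "\<bar>v\<bar>"] by (simp add: power2_eq_square mult_ac flip: abs_mult)
      also have "\<dots> \<le> \<bar>B\<bar> * v\<^sup>2"
        by (intro mult_right_mono) auto
      finally have "(\<bar>v\<bar> * \<bar>h v\<bar>) * w v \<le> (\<bar>B\<bar> * v\<^sup>2) * w v"
        using w_nonneg by (intro mult_right_mono) auto
      then show ?thesis using w_nonneg[of v] by (simp add: abs_mult mult_ac)
    qed
    then show "AE v in lborel. norm (v * h v * w v) \<le> norm (B * (v\<^sup>2 * w v))" by simp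
  qed measurable
  have i2: "integrable lborel (\<lambda>v. 2 * v * h v * w v)"
    using integrable_mult_right[OF i1, of 2] by (simp add: mult.assoc)
  have i: "integrable lborel (\<lambda>v. h' v * w v - 2 * v * h v * w v)"
    by (rule Bochner_Integration.integrable_diff[OF w_bound_integrable[OF _ h'] i2]) measurable
  have lim0: "((\<lambda>v. h v * w v) \<longlongrightarrow> 0) F" if "((\<lambda>v. \<bar>v\<bar> * exp (- v\<^sup>2)) \<longlongrightarrow> 0) F" for F
  proof (rule Lim_null_comparison)
    have "norm (h v * w v) \<le> B / sqrt pi * (\<bar>v\<bar> * exp (- v\<^sup>2))" for v
      using mult_right_mono[OF h[of v] w_nonneg[of v]] w_nonneg[of v] by (simp add: abs_mult w_def mult_ac)
    then show "\<forall>\<^sub>F v in F. norm (h v * w v) \<le> B / sqrt pi * (\<bar>v\<bar> * exp (- v\<^sup>2))" by simp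
    show "((\<lambda>v. B / sqrt pi * (\<bar>v\<bar> * exp (- v\<^sup>2))) \<longlongrightarrow> 0) F"
      using tendsto_mult_left[OF that, of "B / sqrt pi"] by simp
  qed
  have "(LBINT v=-\<infinity>..\<infinity>. h' v * w v - 2 * v * h v * w v) = 0 - 0"
  proof (rule interval_integral_FTC_integrable[where F = "\<lambda>v. h v * w v"])
    show "((\<lambda>v. h v * w v) has_vector_derivative h' v * w v - 2 * v * h v * w v) (at v)" for v
      unfolding has_real_derivative_iff_has_vector_derivative[symmetric]
      by (rule DERIV_cong[OF DERIV_mult[OF der w_deriv]]) (simp add: algebra_simps)
    show "isCont (\<lambda>v. h' v * w v - 2 * v * h v * w v) v" for v
      using DERIV_isCont[OF w_deriv[of v]] cont hc by (intro continuous_intros)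
    show "set_integrable lborel (einterval (-\<infinity>) \<infinity>) (\<lambda>v. h' v * w v - 2 * v * h v * w v)"
      using i by (simp add: set_integrable_def)
    have "((\<lambda>v::real. \<bar>v\<bar> * exp (- v\<^sup>2)) \<longlongrightarrow> 0) at_bot" by real_asymp
    then show "(((\<lambda>v. h v * w v) \<circ> real_of_ereal) \<longlongrightarrow> 0) (at_right (-\<infinity>))"
      using lim0 by (simp add: ereal_tendsto_simps)
    have "((\<lambda>v::real. \<bar>v\<bar> * exp (- v\<^sup>2)) \<longlongrightarrow> 0) at_top" by real_asymp
    then show "(((\<lambda>v. h v * w v) \<circ> real_of_ereal) \<longlongrightarrow> 0) (at_left \<infinity>)"
      using lim0 by (simp add: ereal_tendsto_simps)
  qed simp
  then show "(LBINT v. h' v * w v - 2 * v * h v * w v) = 0"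
    by (simp add: interval_lebesgue_integral_def set_lebesgue_integral_def)
qed

text \<open>Differentiation under the integral sign, including one-sided derivatives: at an endpoint of \<open>S\<close> the
  derivative is taken within \<open>S\<close>.\<close>

lemma has_real_derivative_integral:
  fixes f :: "real \<Rightarrow> 'b \<Rightarrow> real"
  assumes S: "convex S" "t \<in> S"
    and int: "\<And>u. u \<in> S \<Longrightarrow> integrable M (f u)"
    and der: "\<And>u v. u \<in> S \<Longrightarrow> ((\<lambda>u. f u v) has_real_derivative f' u v) (at u within S)"
    and bnd: "\<And>u v. u \<in> S \<Longrightarrow> \<bar>f' u v\<bar> \<le> g v" and g: "integrable M g"
    and f': "f' t \<in> borel_measurable M"
  shows "((\<lambda>u. integral\<^sup>L M (f u)) has_real_derivative integral\<^sup>L M (f' t)) (at t within S)"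
  unfolding has_field_derivative_iff tendsto_at_iff_sequentially
proof (intro allI impI)
  fix X :: "nat \<Rightarrow> real" assume X: "\<forall>i. X i \<in> S - {t}" "X \<longlonglongrightarrow> t"
  let ?q = "\<lambda>i v. (f (X i) v - f t v) / (X i - t)"
  have "(\<lambda>i. integral\<^sup>L M (?q i)) \<longlonglongrightarrow> integral\<^sup>L M (f' t)"
  proof (rule integral_dominated_convergence[where w = g])
    show "AE v in M. (\<lambda>i. ?q i v) \<longlonglongrightarrow> f' t v"
      using der[OF S(2)] X unfolding has_field_derivative_iff tendsto_at_iff_sequentially
      by (auto simp: o_def)
    fix i
    show "?q i \<in> borel_measurable M"
      using int[OF S(2)] int[of "X i"] X(1) by auto
    have "norm (?q i v) \<le> g v" for v
    proof -
      have "norm (f (X i) v - f t v) \<le> g v * norm (X i - t)"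
        using X(1) S der[of _ v] bnd by (intro field_differentiable_bound[OF S(1)]) auto
      then show ?thesis using X(1) by (auto simp: divide_simps)
    qed
    then show "AE v in M. norm (?q i v) \<le> g v" by simp
  qed (use f' g in auto)
  moreover have "integral\<^sup>L M (?q i) = (integral\<^sup>L M (f (X i)) - integral\<^sup>L M (f t)) / (X i - t)" for i
    using Bochner_Integration.integral_diff[OF int[of "X i"] int[OF S(2)]] X(1) by simp
  ultimately show "((\<lambda>y. (integral\<^sup>L M (f y) - integral\<^sup>L M (f t)) / (y - t)) \<circ> X) \<longlonglongrightarrow> integral\<^sup>L M (f' t)"
    by (simp only: o_def)
qed

section \<open>The dispersion integral as a function of \<open>1 + \<lambda>\<close> and \<open>\<tau>\<close>\<close>

text \<open>The integral in \<open>\<omega>(\<lambda>, \<xi>)\<close> without its odd part, with \<open>a = 1 + \<lambda>\<close> and \<open>t = \<xi>\<^sup>2\<close>. It is meaningful for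
  \<open>a \<noteq> 0\<close> of either sign and \<open>t \<ge> 0\<close>.\<close>

definition kappa :: "real \<Rightarrow> real \<Rightarrow> real" where
  "kappa a t = (LBINT v. a / (a\<^sup>2 + v\<^sup>2 * t) * w v)"

lemma denom_bounds:
  fixes a t v c :: real
  assumes "0 < c" "c \<le> \<bar>a\<bar>" "0 \<le> t"
  shows "0 < a\<^sup>2 + v\<^sup>2 * t" "c\<^sup>2 \<le> a\<^sup>2 + v\<^sup>2 * t" "\<bar>a\<bar> / (a\<^sup>2 + v\<^sup>2 * t) \<le> 1 / c"
proof -
  have "c\<^sup>2 \<le> a\<^sup>2" using assms power_mono[of c "\<bar>a\<bar>" 2] by simp
  moreover have "0 \<le> v\<^sup>2 * t" using assms by simp
  ultimately show *: "c\<^sup>2 \<le> a\<^sup>2 + v\<^sup>2 * t" by simp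
  with assms show D: "0 < a\<^sup>2 + v\<^sup>2 * t"
    by (smt (verit) zero_less_power)
  have "\<bar>a\<bar> * c \<le> \<bar>a\<bar> * \<bar>a\<bar>" using assms by (intro mult_left_mono) auto
  also have "\<dots> \<le> a\<^sup>2 + v\<^sup>2 * t" using assms(3) by (simp add: power2_eq_square abs_mult_self_eq)
  finally show "\<bar>a\<bar> / (a\<^sup>2 + v\<^sup>2 * t) \<le> 1 / c" using D assms by (simp add: field_simps)
qed

lemma kappa_integrable:
  assumes "a \<noteq> 0" "0 \<le> t"
  shows "integrable lborel (\<lambda>v. a / (a\<^sup>2 + v\<^sup>2 * t) * w v)"
proof (rule w_bound_integrable)
  fix v
  show "\<bar>a / (a\<^sup>2 + v\<^sup>2 * t)\<bar> \<le> 1 / \<bar>a\<bar>"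
    using denom_bounds[of "\<bar>a\<bar>" a t v] assms by (simp only: abs_divide) simp
qed measurable

text \<open>The derivatives of \<open>kappa\<close>: first and second in \<open>a\<close>, first in \<open>t\<close> (one-sided at \<open>t = 0\<close>).\<close>

definition kappa_a :: "real \<Rightarrow> real \<Rightarrow> real" where
  "kappa_a a t = (LBINT v. (v\<^sup>2 * t - a\<^sup>2) / (a\<^sup>2 + v\<^sup>2 * t)\<^sup>2 * w v)"

definition kappa_aa :: "real \<Rightarrow> real \<Rightarrow> real" where
  "kappa_aa a t = (LBINT v. (2 * a ^ 3 - 6 * a * v\<^sup>2 * t) / (a\<^sup>2 + v\<^sup>2 * t) ^ 3 * w v)"

definition kappa_t :: "real \<Rightarrow> real \<Rightarrow> real" where
  "kappa_t a t = - (LBINT v. a * v\<^sup>2 / (a\<^sup>2 + v\<^sup>2 * t)\<^sup>2 * w v)"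

lemma kappa_a_bound:
  fixes a t v c :: real
  assumes "0 < c" "c \<le> \<bar>a\<bar>" "0 \<le> t"
  shows "\<bar>(v\<^sup>2 * t - a\<^sup>2) / (a\<^sup>2 + v\<^sup>2 * t)\<^sup>2\<bar> \<le> 1 / c\<^sup>2"
proof -
  note D = denom_bounds[OF assms, of v]
  have "0 \<le> v\<^sup>2 * t" using assms by simp
  then have "\<bar>v\<^sup>2 * t - a\<^sup>2\<bar> \<le> a\<^sup>2 + v\<^sup>2 * t"
    using zero_le_power2[of a] by linarith
  then have "\<bar>v\<^sup>2 * t - a\<^sup>2\<bar> / (a\<^sup>2 + v\<^sup>2 * t)\<^sup>2 \<le> (a\<^sup>2 + v\<^sup>2 * t) / (a\<^sup>2 + v\<^sup>2 * t)\<^sup>2"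
    by (intro divide_right_mono) auto
  also have "\<dots> = 1 / (a\<^sup>2 + v\<^sup>2 * t)" using D(1) by (simp add: power2_eq_square)
  also have "\<dots> \<le> 1 / c\<^sup>2" using D assms(1) by (intro divide_left_mono) auto
  finally show ?thesis by (simp add: abs_divide)
qed

lemma kappa_aa_bound:
  fixes a t v c :: real
  assumes "0 < c" "c \<le> \<bar>a\<bar>" "0 \<le> t"
  shows "\<bar>(2 * a ^ 3 - 6 * a * v\<^sup>2 * t) / (a\<^sup>2 + v\<^sup>2 * t) ^ 3\<bar> \<le> 6 / c ^ 3"
proof -
  let ?D = "a\<^sup>2 + v\<^sup>2 * t"
  note D = denom_bounds[OF assms, of v]
  have "\<bar>2 * p - 6 * q\<bar> \<le> 6 * (p + q)" if "0 \<le> p" "0 \<le> q" for p q :: real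
    using that by (auto simp: abs_le_iff)
  from this[of "a\<^sup>2" "v\<^sup>2 * t"] have "\<bar>2 * a\<^sup>2 - 6 * (v\<^sup>2 * t)\<bar> \<le> 6 * ?D"
    using assms by simp
  then have "\<bar>a\<bar> * \<bar>2 * a\<^sup>2 - 6 * (v\<^sup>2 * t)\<bar> / ?D ^ 3 \<le> \<bar>a\<bar> * (6 * ?D) / ?D ^ 3"
    using D(1) by (intro divide_right_mono mult_left_mono) auto
  also have "\<dots> = 6 * ((\<bar>a\<bar> / ?D) * (1 / ?D))"
    using D(1) by (simp only: power3_eq_cube) (simp del: distrib_left_numeral)
  also have "\<dots> \<le> 6 * ((1 / c) * (1 / c\<^sup>2))"
    using D assms(1) by (intro mult_left_mono mult_mono D(3) divide_left_mono) auto
  also have "\<dots> = 6 / c ^ 3" by (simp add: power3_eq_cube power2_eq_square)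
  finally have "\<bar>a\<bar> * \<bar>2 * a\<^sup>2 - 6 * (v\<^sup>2 * t)\<bar> / ?D ^ 3 \<le> 6 / c ^ 3" .
  moreover have "2 * a ^ 3 - 6 * a * v\<^sup>2 * t = a * (2 * a\<^sup>2 - 6 * (v\<^sup>2 * t))"
    by (simp add: power3_eq_cube power2_eq_square algebra_simps)
  ultimately show ?thesis using D(1) by (simp add: abs_divide abs_mult)
qed

lemma kappa_t_bound:
  fixes a t v :: real
  assumes "a \<noteq> 0" "0 \<le> t"
  shows "\<bar>a / (a\<^sup>2 + v\<^sup>2 * t)\<^sup>2\<bar> \<le> 1 / \<bar>a\<bar> ^ 3"
proof -
  let ?D = "a\<^sup>2 + v\<^sup>2 * t"
  have c: "0 < \<bar>a\<bar>" "\<bar>a\<bar> \<le> \<bar>a\<bar>" using assms by auto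
  note D = denom_bounds[OF c assms(2), of v]
  have "\<bar>a / ?D\<^sup>2\<bar> = (\<bar>a\<bar> / ?D) * (1 / ?D)"
    using D(1) by (simp add: power2_eq_square abs_mult)
  also have "\<dots> \<le> (1 / \<bar>a\<bar>) * (1 / \<bar>a\<bar>\<^sup>2)"
    using D c(1) by (intro mult_mono D(3) divide_left_mono) auto
  also have "\<dots> = 1 / \<bar>a\<bar> ^ 3" by (simp add: power3_eq_cube power2_eq_square)
  finally show ?thesis .
qed

lemma half_ball:
  fixes a u :: real
  assumes "a \<noteq> 0" "u \<in> ball a (\<bar>a\<bar> / 2)"
  shows "u \<noteq> 0" "0 < \<bar>a\<bar> / 2" "\<bar>a\<bar> / 2 \<le> \<bar>u\<bar>"
  using assms by (auto simp: dist_real_def abs_if split: if_splits)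

lemma kappa_deriv_a:
  assumes "a \<noteq> 0" "0 \<le> t"
  shows "((\<lambda>a. kappa a t) has_real_derivative kappa_a a t) (at a)"
proof -
  let ?S = "ball a (\<bar>a\<bar> / 2)"
  have "((\<lambda>a. kappa a t) has_real_derivative kappa_a a t) (at a within ?S)"
    unfolding kappa_def[abs_def] kappa_a_def
  proof (rule has_real_derivative_integral[where g = "\<lambda>v. 1 / (\<bar>a\<bar> / 2)\<^sup>2 * w v" and
        f' = "\<lambda>u v. (v\<^sup>2 * t - u\<^sup>2) / (u\<^sup>2 + v\<^sup>2 * t)\<^sup>2 * w v"])
    fix u v assume u: "u \<in> ?S"
    note ub = half_ball[OF assms(1) u]
    note D = denom_bounds[OF ub(2,3) assms(2), of v]
    show "integrable lborel (\<lambda>v. u / (u\<^sup>2 + v\<^sup>2 * t) * w v)"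
      using kappa_integrable[OF ub(1) assms(2)] .
    have "((\<lambda>u. u / (u\<^sup>2 + v\<^sup>2 * t)) has_real_derivative (v\<^sup>2 * t - u\<^sup>2) / (u\<^sup>2 + v\<^sup>2 * t)\<^sup>2) (at u within ?S)"
      using D(1) by (auto intro!: derivative_eq_intros simp: power2_eq_square)
    from DERIV_cmult_right[OF this]
    show "((\<lambda>u. u / (u\<^sup>2 + v\<^sup>2 * t) * w v) has_real_derivative (v\<^sup>2 * t - u\<^sup>2) / (u\<^sup>2 + v\<^sup>2 * t)\<^sup>2 * w v) (at u within ?S)" .
    show "\<bar>(v\<^sup>2 * t - u\<^sup>2) / (u\<^sup>2 + v\<^sup>2 * t)\<^sup>2 * w v\<bar> \<le> 1 / (\<bar>a\<bar> / 2)\<^sup>2 * w v"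
      unfolding abs_mult using mult_right_mono[OF kappa_a_bound[OF ub(2,3) assms(2)] w_nonneg[of v]] w_nonneg[of v]
      by (metis abs_of_nonneg)
  qed (use assms w_integrable in auto)
  then show ?thesis using assms by (subst (asm) at_within_open) auto
qed

lemma kappa_deriv_aa:
  assumes "a \<noteq> 0" "0 \<le> t"
  shows "((\<lambda>a. kappa_a a t) has_real_derivative kappa_aa a t) (at a)"
proof -
  let ?S = "ball a (\<bar>a\<bar> / 2)"
  have "((\<lambda>a. kappa_a a t) has_real_derivative kappa_aa a t) (at a within ?S)"
    unfolding kappa_a_def[abs_def] kappa_aa_def
  proof (rule has_real_derivative_integral[where g = "\<lambda>v. 6 / (\<bar>a\<bar> / 2) ^ 3 * w v" and
        f' = "\<lambda>u v. (2 * u ^ 3 - 6 * u * v\<^sup>2 * t) / (u\<^sup>2 + v\<^sup>2 * t) ^ 3 * w v"])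
    fix u v assume u: "u \<in> ?S"
    note ub = half_ball[OF assms(1) u]
    note D = denom_bounds[OF ub(2,3) assms(2), of v]
    show "integrable lborel (\<lambda>v. (v\<^sup>2 * t - u\<^sup>2) / (u\<^sup>2 + v\<^sup>2 * t)\<^sup>2 * w v)"
      by (rule w_bound_integrable[OF _ kappa_a_bound[OF ub(2,3) assms(2)]]) measurable
    have "((\<lambda>u. (v\<^sup>2 * t - u\<^sup>2) / (u\<^sup>2 + v\<^sup>2 * t)\<^sup>2) has_real_derivative
        (- (2 * u) * (u\<^sup>2 + v\<^sup>2 * t)\<^sup>2 - (v\<^sup>2 * t - u\<^sup>2) * (2 * (u\<^sup>2 + v\<^sup>2 * t) * (2 * u))) / ((u\<^sup>2 + v\<^sup>2 * t)\<^sup>2 * (u\<^sup>2 + v\<^sup>2 * t)\<^sup>2)) (at u within ?S)"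
      using D(1) by (auto intro!: derivative_eq_intros)
    moreover have "(- (2 * u) * E\<^sup>2 - (E - 2 * u\<^sup>2) * (2 * E * (2 * u))) / (E\<^sup>2 * E\<^sup>2) = (8 * u ^ 3 - 6 * u * E) / E ^ 3"
      if "0 < E" for E
      using that by (simp add: field_simps power2_eq_square power3_eq_cube)
    from this[OF D(1)] have "(- (2 * u) * (u\<^sup>2 + v\<^sup>2 * t)\<^sup>2 - (v\<^sup>2 * t - u\<^sup>2) * (2 * (u\<^sup>2 + v\<^sup>2 * t) * (2 * u))) / ((u\<^sup>2 + v\<^sup>2 * t)\<^sup>2 * (u\<^sup>2 + v\<^sup>2 * t)\<^sup>2) = (2 * u ^ 3 - 6 * u * v\<^sup>2 * t) / (u\<^sup>2 + v\<^sup>2 * t) ^ 3"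
      by (simp add: algebra_simps power3_eq_cube power2_eq_square)
    ultimately have "((\<lambda>u. (v\<^sup>2 * t - u\<^sup>2) / (u\<^sup>2 + v\<^sup>2 * t)\<^sup>2) has_real_derivative
         (2 * u ^ 3 - 6 * u * v\<^sup>2 * t) / (u\<^sup>2 + v\<^sup>2 * t) ^ 3) (at u within ?S)" by (simp only:)
    from DERIV_cmult_right[OF this]
    show "((\<lambda>u. (v\<^sup>2 * t - u\<^sup>2) / (u\<^sup>2 + v\<^sup>2 * t)\<^sup>2 * w v) has_real_derivative
        (2 * u ^ 3 - 6 * u * v\<^sup>2 * t) / (u\<^sup>2 + v\<^sup>2 * t) ^ 3 * w v) (at u within ?S)" .
    show "\<bar>(2 * u ^ 3 - 6 * u * v\<^sup>2 * t) / (u\<^sup>2 + v\<^sup>2 * t) ^ 3 * w v\<bar> \<le> 6 / (\<bar>a\<bar> / 2) ^ 3 * w v"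
      unfolding abs_mult using mult_right_mono[OF kappa_aa_bound[OF ub(2,3) assms(2)] w_nonneg[of v]] w_nonneg[of v]
      by (metis abs_of_nonneg)
  qed (use assms w_integrable in auto)
  then show ?thesis using assms by (subst (asm) at_within_open) auto
qed

lemma kappa_deriv_t:
  assumes "a \<noteq> 0" "0 \<le> t"
  shows "((\<lambda>t. kappa a t) has_real_derivative kappa_t a t) (at t within {0..})"
proof -
  have "((\<lambda>t. kappa a t) has_real_derivative (LBINT v. - (a / (a\<^sup>2 + v\<^sup>2 * t)\<^sup>2) * v\<^sup>2 * w v)) (at t within {0..})"
    unfolding kappa_def[abs_def]
  proof (rule has_real_derivative_integral[where g = "\<lambda>v. 1 / \<bar>a\<bar> ^ 3 * (v\<^sup>2 * w v)" and
        f' = "\<lambda>u v. - (a / (a\<^sup>2 + v\<^sup>2 * u)\<^sup>2) * v\<^sup>2 * w v"])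
    fix u v :: real assume u: "u \<in> {0..}"
    then have "0 \<le> u" by simp
    note D = denom_bounds[of "\<bar>a\<bar>" a u v]
    show "integrable lborel (\<lambda>v. a / (a\<^sup>2 + v\<^sup>2 * u) * w v)"
      using kappa_integrable[OF assms(1) \<open>0 \<le> u\<close>] .
    have "((\<lambda>u. a / (a\<^sup>2 + v\<^sup>2 * u)) has_real_derivative - (a / (a\<^sup>2 + v\<^sup>2 * u)\<^sup>2) * v\<^sup>2) (at u within {0..})"
      using D(1) assms(1) \<open>0 \<le> u\<close> by (auto intro!: derivative_eq_intros simp: power2_eq_square)
    from DERIV_cmult_right[OF this]
    show "((\<lambda>u. a / (a\<^sup>2 + v\<^sup>2 * u) * w v) has_real_derivative - (a / (a\<^sup>2 + v\<^sup>2 * u)\<^sup>2) * v\<^sup>2 * w v) (at u within {0..})" .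
    have "\<bar>a / (a\<^sup>2 + v\<^sup>2 * u)\<^sup>2\<bar> * (v\<^sup>2 * w v) \<le> 1 / \<bar>a\<bar> ^ 3 * (v\<^sup>2 * w v)"
      using kappa_t_bound[OF assms(1) \<open>0 \<le> u\<close>] w_nonneg by (intro mult_right_mono) auto
    then show "\<bar>- (a / (a\<^sup>2 + v\<^sup>2 * u)\<^sup>2) * v\<^sup>2 * w v\<bar> \<le> 1 / \<bar>a\<bar> ^ 3 * (v\<^sup>2 * w v)"
      using w_nonneg[of v] by (simp only: abs_mult abs_minus_cancel abs_of_nonneg zero_le_power2 mult.assoc)
  qed (use assms w_second_moment_integrable in auto)
  then show ?thesis by (simp add: kappa_t_def)
qed

text \<open>Integration by parts with \<open>h v = a v / (a\<^sup>2 + v\<^sup>2 t)\<^sup>2\<close>, whose derivative is half the integrand of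
  \<open>kappa_aa\<close>.\<close>

lemma kappa_heat:
  assumes "a \<noteq> 0" "0 \<le> t"
  shows "kappa_t a t = - kappa_aa a t / 4"
    and "integrable lborel (\<lambda>v. a * v\<^sup>2 / (a\<^sup>2 + v\<^sup>2 * t)\<^sup>2 * w v)"
proof -
  let ?D = "\<lambda>v. a\<^sup>2 + v\<^sup>2 * t"
  have c: "0 < \<bar>a\<bar>" "\<bar>a\<bar> \<le> \<bar>a\<bar>" using assms by auto
  note D = denom_bounds[OF c assms(2)]
  let ?h = "\<lambda>v. v * (a / (?D v)\<^sup>2)" and ?h' = "\<lambda>v. (2 * a ^ 3 - 6 * a * v\<^sup>2 * t) / ?D v ^ 3 / 2"
  have der: "(?h has_real_derivative ?h' v) (at v)" for v
  proof -
    have "(?h has_real_derivative (a * (?D v)\<^sup>2 - v * a * (4 * (v * (t * ?D v)))) / (?D v) ^ 4) (at v)"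
      using D(1)[of v] by (auto intro!: derivative_eq_intros)
    moreover have "(a * E\<^sup>2 - v * a * (4 * (v * (t * E)))) / E ^ 4 = (2 * a * E - 8 * a * v\<^sup>2 * t) / E ^ 3 / 2"
      if "0 < E" for E
      using that by (simp add: field_simps eval_nat_numeral)
    from this[OF D(1)[of v]] have "(a * (?D v)\<^sup>2 - v * a * (4 * (v * (t * ?D v)))) / (?D v) ^ 4 = ?h' v"
      by (simp add: algebra_simps power3_eq_cube power2_eq_square)
    ultimately show ?thesis by (simp only:)
  qed
  have cont: "isCont ?h' v" for v
    using D(1)[of v] by (intro continuous_intros) auto
  have h: "\<bar>?h v\<bar> \<le> 1 / \<bar>a\<bar> ^ 3 * \<bar>v\<bar>" for v
    unfolding abs_mult using mult_right_mono[OF kappa_t_bound[OF assms, of v] abs_ge_zero[of v]] by (simp add: mult.commute)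
  have h': "\<bar>?h' v\<bar> \<le> 6 / \<bar>a\<bar> ^ 3 / 2" for v
    unfolding abs_divide[of _ 2] using kappa_aa_bound[OF c assms(2), of v] by simp
  note parts = w_integral_by_parts[OF der cont h h']
  have eq: "2 * v * ?h v * w v = 2 * (a * v\<^sup>2 / (?D v)\<^sup>2 * w v)" for v
    by (simp add: power2_eq_square)
  show int: "integrable lborel (\<lambda>v. a * v\<^sup>2 / (?D v)\<^sup>2 * w v)"
    using parts(2) by (simp add: power2_eq_square mult_ac)
  have int': "integrable lborel (\<lambda>v. ?h' v * w v)"
    by (rule w_bound_integrable[OF _ h']) measurable
  have "(LBINT v. ?h' v * w v) - 2 * (LBINT v. a * v\<^sup>2 / (?D v)\<^sup>2 * w v) = 0"
    using parts(1) unfolding eq integral_mult_right_zero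
      Bochner_Integration.integral_diff[OF int' integrable_mult_right[OF int, of 2]] .
  moreover have "(LBINT v. ?h' v * w v) = kappa_aa a t / 2"
    unfolding kappa_aa_def by (subst integral_divide_zero[symmetric]) simp
  ultimately show "kappa_t a t = - kappa_aa a t / 4"
    by (simp add: kappa_t_def)
qed

text \<open>Integration by parts with \<open>h v = a v / (a\<^sup>2 + v\<^sup>2 t)\<close>. With \<open>t = x\<^sup>2\<close>, this is the differential
  equation of \<open>\<omega>\<close> in \<open>x\<close>.\<close>

lemma kappa_ode:
  assumes "a \<noteq> 0" "0 \<le> t"
  shows "t * (kappa a t + 2 * t * kappa_t a t) = 2 * a * (1 - a * kappa a t)"
proof -
  let ?D = "\<lambda>v. a\<^sup>2 + v\<^sup>2 * t"
  have c: "0 < \<bar>a\<bar>" "\<bar>a\<bar> \<le> \<bar>a\<bar>" using assms by auto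
  note D = denom_bounds[OF c assms(2)]
  let ?h = "\<lambda>v. v * (a / ?D v)" and ?h' = "\<lambda>v. - a * ((v\<^sup>2 * t - a\<^sup>2) / (?D v)\<^sup>2)"
  have der: "(?h has_real_derivative ?h' v) (at v)" for v
  proof -
    have "(?h has_real_derivative (a * ?D v - v * a * (2 * v * t)) / (?D v * ?D v)) (at v)"
      using D(1)[of v] by (auto intro!: derivative_eq_intros)
    moreover have "(a * E - v * a * (2 * v * t)) / (E * E) = - a * ((2 * v\<^sup>2 * t - E) / E\<^sup>2)"
      if "0 < E" for E
      using that by (simp add: field_simps power2_eq_square)
    from this[OF D(1)[of v]] have "(a * ?D v - v * a * (2 * v * t)) / (?D v * ?D v) = ?h' v"
      by (simp add: algebra_simps)
    ultimately show ?thesis by (simp only:)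
  qed
  have cont: "isCont ?h' v" for v
    using D(1)[of v] by (intro continuous_intros) auto
  have h: "\<bar>?h v\<bar> \<le> 1 / \<bar>a\<bar> * \<bar>v\<bar>" for v
    using mult_right_mono[OF D(3)[of v] abs_ge_zero[of v]] D(1)[of v] by (simp add: abs_mult mult.commute)
  have h': "\<bar>?h' v\<bar> \<le> \<bar>a\<bar> * (1 / \<bar>a\<bar>\<^sup>2)" for v
    unfolding abs_mult using kappa_a_bound[OF c assms(2), of v] by (intro mult_mono) auto
  note parts = w_integral_by_parts(1)[OF der cont h h']
  have eq: "t * (?h' v * w v - 2 * v * ?h v * w v) =
      (t + 2 * a\<^sup>2) * (a / ?D v * w v) - 2 * t\<^sup>2 * (a * v\<^sup>2 / (?D v)\<^sup>2 * w v) - 2 * a * w v" for v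
  proof -
    have "t * (- a * ((v\<^sup>2 * t - a\<^sup>2) / E\<^sup>2)) - t * (2 * v * (v * (a / E))) =
        (t + 2 * a\<^sup>2) * (a / E) - 2 * t\<^sup>2 * (a * v\<^sup>2 / E\<^sup>2) - 2 * a" if "E = ?D v" for E
    proof -
      have E: "0 < E" "v\<^sup>2 * t - a\<^sup>2 = E - 2 * a\<^sup>2" using that D(1) by simp_all
      have red: "- (t * a * (E - 2 * a\<^sup>2) / E\<^sup>2) - 2 * (E - a\<^sup>2) * (a / E) =
          (t + 2 * a\<^sup>2) * (a / E) - 2 * t * (a * (E - a\<^sup>2) / E\<^sup>2) - 2 * a"
        using E(1) by (simp add: field_simps power2_eq_square)
      have vt: "v\<^sup>2 * t = E - a\<^sup>2" using that by simp
      have r: "t * (2 * v * (v * (a / E))) = 2 * (v\<^sup>2 * t) * (a / E)"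
        "2 * t\<^sup>2 * (a * v\<^sup>2 / E\<^sup>2) = 2 * t * (a * (v\<^sup>2 * t) / E\<^sup>2)"
        "t * (- a * (p / E\<^sup>2)) = - (t * a * p / E\<^sup>2)" for p
        by (simp_all add: power2_eq_square mult_ac)
      show ?thesis unfolding r E(2) unfolding vt by (rule red)
    qed
    note eq = this[OF refl]
    have "t * (p * z - 2 * v * q * z) = (t * p - t * (2 * v * q)) * z"
      and "(p * q - r * s - b) * z = p * (q * z) - r * (s * z) - b * z" for p q r s b z
      by (simp_all add: algebra_simps)
    then show ?thesis using eq by (simp only:)
  qed
  note ki = kappa_integrable[OF assms] and ti = kappa_heat(2)[OF assms]
  have "0 = (LBINT v. t * (?h' v * w v - 2 * v * ?h v * w v))"
    using parts by simp
  also have "\<dots> = (t + 2 * a\<^sup>2) * kappa a t + 2 * t\<^sup>2 * kappa_t a t - 2 * a"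
    unfolding eq kappa_def kappa_t_def integral_mult_right_zero w_integral
      Bochner_Integration.integral_diff[OF Bochner_Integration.integrable_diff[OF integrable_mult_right[OF ki]
        integrable_mult_right[OF ti]] integrable_mult_right[OF w_integrable]]
      Bochner_Integration.integral_diff[OF integrable_mult_right[OF ki] integrable_mult_right[OF ti]]
    by simp
  finally show ?thesis by algebra
qed

section \<open>The heat equation and the differential equation for \<open>\<omega>\<close>\<close>

lemma omega_eq_kappa:
  assumes "l \<noteq> -1"
  shows "omega (of_real l) x = of_real (1 - kappa (1 + l) (x\<^sup>2))"
proof -
  define a where "a = 1 + l"
  have a: "a \<noteq> 0" using assms by (simp add: a_def)
  let ?D = "\<lambda>v. a\<^sup>2 + v\<^sup>2 * x\<^sup>2"
  have D: "0 < ?D v" for v using a by (intro add_pos_nonneg) auto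
  let ?o = "\<lambda>v. x * v / ?D v * w v"
  have o_int: "integrable lborel ?o"
  proof (rule w_bound_integrable)
    fix v
    have "2 * (\<bar>x * v\<bar> * \<bar>a\<bar>) \<le> ?D v"
      using sum_squares_bound[of "\<bar>x * v\<bar>" "\<bar>a\<bar>"] by (simp add: power_mult_distrib mult_ac)
    moreover have "0 \<le> \<bar>x * v\<bar> * \<bar>a\<bar>" by simp
    ultimately have "\<bar>x * v\<bar> * \<bar>a\<bar> \<le> ?D v" by linarith
    then show "\<bar>x * v / ?D v\<bar> \<le> 1 / \<bar>a\<bar>"
      using D[of v] a by (simp add: abs_divide divide_le_eq le_divide_eq mult.commute)
  qed measurable
  have o_zero: "(LBINT v. ?o v) = 0"
    using lborel_integral_real_affine[of "-1" ?o 0] by (simp add: w_minus)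
  have "complex_of_real (w v) / (\<i> * of_real v * of_real x + 1 + of_real l) =
      of_real (a / ?D v * w v) - \<i> * of_real (?o v)" for v
  proof -
    have "(of_real a + \<i> * of_real (v * x)) * (of_real a - \<i> * of_real (v * x)) = complex_of_real (?D v)"
      by (simp add: algebra_simps power2_eq_square complex_eq_iff)
    then have PQ: "of_real (w v) * (of_real a - \<i> * of_real (v * x)) / ((of_real a + \<i> * of_real (v * x)) * (of_real a - \<i> * of_real (v * x)))
        = of_real (w v) * (of_real a - \<i> * of_real (v * x)) / complex_of_real (?D v)"
      by (simp only:)
    have "(of_real a - \<i> * of_real (v * x)) \<noteq> 0" using a by (simp add: complex_eq_iff)
    from nonzero_mult_divide_mult_cancel_right[OF this] PQ
    have "of_real (w v) / (of_real a + \<i> * of_real (v * x)) =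
        of_real (w v) * (of_real a - \<i> * of_real (v * x)) / complex_of_real (?D v)"
      by simp
    then show ?thesis by (simp add: a_def algebra_simps diff_divide_distrib add_divide_distrib)
  qed
  then have "omega (of_real l) x = 1 - (LBINT v. complex_of_real (a / ?D v * w v) - \<i> * of_real (?o v))"
    by (simp only: omega_def)
  also have "(LBINT v. complex_of_real (a / ?D v * w v) - \<i> * of_real (?o v)) =
      of_real (kappa a (x\<^sup>2)) - \<i> * of_real (LBINT v. ?o v)"
    unfolding kappa_def integral_complex_of_real[symmetric] integral_mult_right_zero[symmetric]
    using kappa_integrable[of a "x\<^sup>2"] a o_int
    by (intro Bochner_Integration.integral_diff integrable_mult_right integrable_of_real) auto
  finally show ?thesis unfolding o_zero by (simp add: a_def)
qed

lemma kappa_eq_integral: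
  "kappa a (x\<^sup>2) = (LBINT v. a * w v / (a\<^sup>2 + (v * x)\<^sup>2))"
  by (simp add: kappa_def power_mult_distrib)

lemma kappa_0: "a \<noteq> 0 \<Longrightarrow> kappa a 0 = 1 / a"
  by (simp add: kappa_def w_integral power2_eq_square)

lemma omega_0: "l \<noteq> -1 \<Longrightarrow> omega (of_real l) 0 = of_real (1 - 1 / (1 + l))"
  using omega_eq_kappa[of l 0] by (simp add: kappa_0 add_eq_0_iff)

lemma omega_isCont_0:
  assumes "l \<noteq> -1"
  shows "isCont (omega (of_real l)) 0"
proof -
  have "continuous (at 0 within {0..}) (kappa (1 + l))"
    using kappa_deriv_t[of "1 + l" 0] assms
    by (intro has_derivative_continuous[OF has_field_derivative_imp_has_derivative]) (auto simp: add_eq_0_iff)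
  then have "(kappa (1 + l) \<longlongrightarrow> kappa (1 + l) 0) (at 0 within {0..})"
    by (simp add: continuous_within)
  moreover have "filterlim (\<lambda>x::real. x\<^sup>2) (at 0 within {0..}) (at 0)"
    unfolding filterlim_at by (auto simp: eventually_at_filter intro!: tendsto_eq_intros)
  ultimately have "((\<lambda>x. kappa (1 + l) (x\<^sup>2)) \<longlongrightarrow> kappa (1 + l) 0) (at 0)"
    by (rule filterlim_compose)
  then show ?thesis
    unfolding isCont_def omega_eq_kappa[OF assms, abs_def] by (auto intro!: tendsto_intros)
qed

lemma omega_deriv:
  assumes "l \<noteq> -1" "x \<noteq> 0"
  shows "(omega (of_real l) has_vector_derivative of_real (- 2 * x * kappa_t (1 + l) (x\<^sup>2))) (at x)"
proof -
  have a: "1 + l \<noteq> 0" using assms by (simp add: add_eq_0_iff)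
  have "at (x\<^sup>2) within {0..} = at (x\<^sup>2)"
    using assms by (intro at_within_interior) auto
  then have "(kappa (1 + l) has_real_derivative kappa_t (1 + l) (x\<^sup>2)) (at (x\<^sup>2))"
    using kappa_deriv_t[OF a, of "x\<^sup>2"] by simp
  moreover have "((\<lambda>x. x\<^sup>2) has_real_derivative 2 * x) (at x)"
    by (auto intro!: derivative_eq_intros)
  ultimately have "((\<lambda>x. kappa (1 + l) (x\<^sup>2)) has_real_derivative kappa_t (1 + l) (x\<^sup>2) * (2 * x)) (at x)"
    by (rule DERIV_chain2)
  then have "((\<lambda>x. 1 - kappa (1 + l) (x\<^sup>2)) has_real_derivative - 2 * x * kappa_t (1 + l) (x\<^sup>2)) (at x)"
    by (auto intro!: derivative_eq_intros)
  from has_vector_derivative_of_real[OF this] show ?thesis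
    by (simp add: omega_eq_kappa[OF assms(1), abs_def])
qed

lemma omega_solves_ode:
  assumes "l \<noteq> -1"
  shows "solves_omega_ode l (omega (of_real l)) (- {0})"
  unfolding solves_omega_ode_def
proof (intro ballI conjI exI)
  fix x :: real assume "x \<in> - {0}"
  then show x: "x \<noteq> 0" by simp
  show "(omega (of_real l) has_vector_derivative of_real (- 2 * x * kappa_t (1 + l) (x\<^sup>2))) (at x)"
    using omega_deriv[OF assms x] .
  let ?K = "kappa (1 + l) (x\<^sup>2)" and ?T = "kappa_t (1 + l) (x\<^sup>2)" and ?a = "1 + l"
  have ode: "x\<^sup>2 * (?K + 2 * x\<^sup>2 * ?T) = 2 * ?a * (1 - ?a * ?K)"
    using kappa_ode[of ?a "x\<^sup>2"] assms by (simp add: add_eq_0_iff)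
  have "x ^ 3 * (- 2 * x * ?T + (1 / x + 2 * ?a\<^sup>2 / x ^ 3) * (1 - ?K)) =
      x ^ 3 * (1 / x + 2 * l * ?a / x ^ 3) - (x\<^sup>2 * (?K + 2 * x\<^sup>2 * ?T) - 2 * ?a * (1 - ?a * ?K))"
    using x by (simp add: field_simps power2_eq_square power3_eq_cube)
  also have "\<dots> = x ^ 3 * (1 / x + 2 * l * ?a / x ^ 3)" using ode by simp
  finally have "- 2 * x * ?T + (1 / x + 2 * ?a\<^sup>2 / x ^ 3) * (1 - ?K) = 1 / x + 2 * l * ?a / x ^ 3"
    using x by simp
  then show "of_real (- 2 * x * ?T) + of_real (1 / x + 2 * ?a\<^sup>2 / x ^ 3) * omega (of_real l) x =
      of_real (1 / x + 2 * l * ?a / x ^ 3)"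
    unfolding omega_eq_kappa[OF assms] of_real_mult[symmetric] of_real_add[symmetric] by (simp only:)
qed

lemma omega_heat_equation:
  fixes s :: real
  assumes s: "s\<^sup>2 = 1"
  shows "\<exists>(P :: real \<Rightarrow> real \<Rightarrow> complex) (Q :: real \<Rightarrow> real \<Rightarrow> complex).
         \<forall>l t. l \<noteq> -1 \<and> 0 \<le> t \<longrightarrow>
           ((\<lambda>k. omega (of_real k) (s * sqrt t)) has_vector_derivative P l t) (at l) \<and>
           ((\<lambda>k. P k t) has_vector_derivative Q l t) (at l) \<and>
           ((\<lambda>u. omega (of_real l) (s * sqrt u)) has_vector_derivative - (1 / 4) * Q l t)
             (at t within {0..})"
proof (rule exI[of _ "\<lambda>l t. of_real (- kappa_a (1 + l) t)"],
    rule exI[of _ "\<lambda>l t. of_real (- kappa_aa (1 + l) t)"], intro allI impI conjI; elim conjE)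
  fix l t :: real assume l: "l \<noteq> -1" and t: "0 \<le> t"
  have a: "1 + l \<noteq> 0" using l by (simp add: add_eq_0_iff)
  have sq: "(s * sqrt u)\<^sup>2 = u" if "0 \<le> u" for u
    using that s by (simp add: power_mult_distrib)
  have shift: "((\<lambda>k. 1 + k) has_real_derivative 1) (at l)"
    by (auto intro!: derivative_eq_intros)
  have "((\<lambda>k. 1 - kappa (1 + k) t) has_real_derivative - kappa_a (1 + l) t) (at l)"
    using DERIV_chain2[OF kappa_deriv_a[OF a t] shift] by (auto intro!: derivative_eq_intros)
  from has_vector_derivative_of_real[OF this]
  show "((\<lambda>k. omega (of_real k) (s * sqrt t)) has_vector_derivative of_real (- kappa_a (1 + l) t)) (at l)"
    by (rule has_vector_derivative_transform_within_open[where S = "- {-1}"])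
      (use l t sq in \<open>auto simp: omega_eq_kappa\<close>)
  have "((\<lambda>k. - kappa_a (1 + k) t) has_real_derivative - kappa_aa (1 + l) t) (at l)"
    using DERIV_chain2[OF kappa_deriv_aa[OF a t] shift] by (auto intro!: derivative_eq_intros)
  from has_vector_derivative_of_real[OF this]
  show "((\<lambda>k. complex_of_real (- kappa_a (1 + k) t)) has_vector_derivative of_real (- kappa_aa (1 + l) t)) (at l)" .
  have "((\<lambda>u. 1 - kappa (1 + l) u) has_real_derivative kappa_aa (1 + l) t / 4) (at t within {0..})"
    using kappa_deriv_t[OF a t] kappa_heat(1)[OF a t] by (auto intro!: derivative_eq_intros)
  from has_vector_derivative_of_real[OF this]
  have "((\<lambda>u. omega (of_real l) (s * sqrt u)) has_vector_derivative of_real (kappa_aa (1 + l) t / 4)) (at t within {0..})"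
    by (rule has_vector_derivative_transform[rotated 2]) (use l t sq in \<open>auto simp: omega_eq_kappa\<close>)
  then show "((\<lambda>u. omega (of_real l) (s * sqrt u)) has_vector_derivative - (1 / 4) * of_real (- kappa_aa (1 + l) t)) (at t within {0..})"
    by simp
qed

section \<open>Solving the equation for \<open>\<omega>\<close>\<close>

text \<open>The oriented integral in \<open>omega_formula\<close>.\<close>

definition omega_primitive :: "real \<Rightarrow> real \<Rightarrow> real" where
  "omega_primitive l x = (LBINT s=0..ereal x. omega_integrand l s)"

lemma omega_integrand_tendsto_0:
  assumes "l \<noteq> -1"
  shows "(omega_integrand l \<longlongrightarrow> 0) (at 0)"
proof -
  have c: "0 < (1 + l)\<^sup>2" using assms by (simp add: add_eq_0_iff)
  have "((\<lambda>s::real. exp (- (c / s\<^sup>2))) \<longlongrightarrow> 0) (at 0)" if "0 < c" for c :: real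
    using that by real_asymp
  moreover have "((\<lambda>s::real. exp (- (c / s\<^sup>2)) / s\<^sup>2) \<longlongrightarrow> 0) (at 0)" if "0 < c" for c :: real
    using that by real_asymp
  ultimately have "((\<lambda>s. exp (- ((1 + l)\<^sup>2 / s\<^sup>2)) + 2 * l * (1 + l) * (exp (- ((1 + l)\<^sup>2 / s\<^sup>2)) / s\<^sup>2)) \<longlongrightarrow> 0 + 2 * l * (1 + l) * 0) (at 0)"
    using c by (intro tendsto_add tendsto_mult tendsto_const)
  then show ?thesis by (simp add: omega_integrand_def[abs_def] algebra_simps)
qed

lemma omega_primitive_FTC:
  assumes "l \<noteq> -1"
  shows "x \<noteq> 0 \<Longrightarrow> (omega_primitive l has_real_derivative omega_integrand l x) (at x)"
    and "(omega_primitive l \<longlongrightarrow> 0) (at 0)"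
proof -
  define g where "g s = (if s = 0 then 0 else omega_integrand l s)" for s
  have g: "isCont g s" for s
  proof (cases "s = 0")
    case True
    have "(g \<longlongrightarrow> 0) (at 0)"
      by (rule Lim_transform_eventually[OF omega_integrand_tendsto_0[OF assms]])
        (auto simp: g_def eventually_at_filter)
    then show ?thesis by (simp add: True isCont_def g_def)
  next
    case False
    have "isCont (omega_integrand l) s"
      unfolding omega_integrand_def[abs_def] using False by (intro continuous_intros) auto
    moreover have "\<forall>\<^sub>F t in nhds s. omega_integrand l t = g t"
      using False by (intro eventually_nhds_in_open[of "- {0}", THEN eventually_mono]) (auto simp: g_def)
    ultimately show ?thesis by (metis isCont_cong)
  qed
  have eq: "omega_primitive l x = (LBINT s=ereal 0..ereal x. g s)" for x
    unfolding omega_primitive_def zero_ereal_def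
    by (rule interval_integral_cong) (auto simp: einterval_def g_def min_def max_def split: if_splits)
  have der: "(omega_primitive l has_real_derivative g x) (at x)" for x
  proof -
    let ?R = "\<bar>x\<bar> + 1"
    have "((\<lambda>x. LBINT s=ereal 0..ereal x. g s) has_vector_derivative g x) (at x within {- ?R..?R})"
      using g by (intro interval_integral_FTC2 continuous_at_imp_continuous_on) auto
    then have "(omega_primitive l has_real_derivative g x) (at x within {- ?R..?R})"
      by (simp add: eq[abs_def] has_real_derivative_iff_has_vector_derivative)
    then show ?thesis by (subst (asm) at_within_interior) auto
  qed
  show "x \<noteq> 0 \<Longrightarrow> (omega_primitive l has_real_derivative omega_integrand l x) (at x)"
    using der[of x] by (simp add: g_def)
  show "(omega_primitive l \<longlongrightarrow> 0) (at 0)"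
    using DERIV_isCont[OF der[of 0]] eq[of 0] by (simp add: isCont_def)
qed

lemma omega_primitive_minus: "omega_primitive l (- x) = - omega_primitive l x"
proof -
  have "omega_primitive l (- x) = (LBINT s=ereal x..0. omega_integrand l (- s))"
    unfolding omega_primitive_def by (subst interval_integral_reflect) simp
  then show ?thesis
    by (simp add: omega_primitive_def omega_integrand_def interval_integral_endpoints_reverse[of "ereal x" 0])
qed

lemma omega_formula_eq: "omega_formula l x = exp ((1 + l)\<^sup>2 / x\<^sup>2) / x * omega_primitive l x"
  by (simp add: omega_formula_def omega_primitive_def)

lemma omega_formula_minus: "omega_formula l (- x) = omega_formula l x"
  by (simp add: omega_formula_eq omega_primitive_minus)

text \<open>The integrating factor is \<open>x * exp (- (1 + l)\<^sup>2 / x\<^sup>2)\<close>.\<close>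

lemma integrating_factor_forward:
  fixes y :: "real \<Rightarrow> complex"
  assumes x: "x \<noteq> 0" and y: "(y has_vector_derivative y') (at x)"
    and ode: "y' + of_real (1 / x + 2 * (1 + l)\<^sup>2 / x ^ 3) * y x = of_real (1 / x + 2 * l * (1 + l) / x ^ 3)"
  shows "((\<lambda>x. of_real (x * exp (- ((1 + l)\<^sup>2 / x\<^sup>2))) * y x) has_vector_derivative of_real (omega_integrand l x)) (at x)"
proof -
  let ?e = "exp (- ((1 + l)\<^sup>2 / x\<^sup>2))" and ?c = "1 / x + 2 * (1 + l)\<^sup>2 / x ^ 3"
  have E: "((\<lambda>x. x * exp (- ((1 + l)\<^sup>2 / x\<^sup>2))) has_real_derivative x * ?e * ?c) (at x)"
    using x by (auto intro!: derivative_eq_intros simp: field_simps eval_nat_numeral)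
  have factor: "of_real p * y' + of_real (p * c) * Y = of_real p * (y' + of_real c * Y)"
    for p c :: real and Y :: complex
    by (simp add: algebra_simps)
  from has_vector_derivative_mult[OF has_vector_derivative_of_real[OF E] y]
  have "((\<lambda>x. of_real (x * exp (- ((1 + l)\<^sup>2 / x\<^sup>2))) * y x) has_vector_derivative
      of_real (x * ?e) * (y' + of_real ?c * y x)) (at x)"
    unfolding factor .
  moreover have "of_real (x * ?e) * (y' + of_real ?c * y x) = of_real (omega_integrand l x)"
    unfolding ode of_real_mult[symmetric]
    using x by (simp add: omega_integrand_def field_simps eval_nat_numeral)
  ultimately show ?thesis by simp
qed

lemma integrating_factor_backward:
  fixes H :: "real \<Rightarrow> complex"
  assumes x: "x \<noteq> 0" and H: "(H has_vector_derivative of_real (omega_integrand l x)) (at x)"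
  defines "c \<equiv> \<lambda>x. exp ((1 + l)\<^sup>2 / x\<^sup>2) / x"
  shows "\<exists>y'. ((\<lambda>x. of_real (c x) * H x) has_vector_derivative y') (at x) \<and>
    y' + of_real (1 / x + 2 * (1 + l)\<^sup>2 / x ^ 3) * (of_real (c x) * H x) = of_real (1 / x + 2 * l * (1 + l) / x ^ 3)"
proof (intro exI conjI)
  let ?p = "1 / x + 2 * (1 + l)\<^sup>2 / x ^ 3"
  have "(c has_real_derivative - c x * ?p) (at x)"
    unfolding c_def using x by (auto intro!: derivative_eq_intros simp: field_simps eval_nat_numeral)
  from has_vector_derivative_mult[OF has_vector_derivative_of_real[OF this] H]
  show "((\<lambda>x. of_real (c x) * H x) has_vector_derivative
    of_real (c x) * of_real (omega_integrand l x) + of_real (- c x * ?p) * H x) (at x)" .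
  have "c x * omega_integrand l x = 1 / x + 2 * l * (1 + l) / x ^ 3"
    using x by (simp add: c_def omega_integrand_def exp_minus field_simps eval_nat_numeral)
  then show "of_real (c x) * of_real (omega_integrand l x) + of_real (- c x * ?p) * H x + of_real ?p * (of_real (c x) * H x)
      = of_real (1 / x + 2 * l * (1 + l) / x ^ 3)"
    by (simp only: of_real_mult[symmetric] of_real_minus) (simp add: algebra_simps)
qed

lemma solves_omega_ode_iff:
  fixes y :: "real \<Rightarrow> complex"
  assumes S: "open S" "0 \<notin> S"
  shows "solves_omega_ode l y S \<longleftrightarrow>
          (\<exists>H :: real \<Rightarrow> complex.
             \<forall>x\<in>S. (H has_vector_derivative of_real (omega_integrand l x)) (at x) \<and>
                   y x = of_real (exp ((1 + l)\<^sup>2 / x\<^sup>2) / x) * H x)" (is "?L \<longleftrightarrow> ?R")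
proof
  assume ?L
  show ?R
  proof (intro exI ballI conjI)
    fix x assume "x \<in> S"
    with \<open>?L\<close> S(2) obtain y' where "x \<noteq> 0" and "(y has_vector_derivative y') (at x)" and
      "y' + of_real (1 / x + 2 * (1 + l)\<^sup>2 / x ^ 3) * y x = of_real (1 / x + 2 * l * (1 + l) / x ^ 3)"
      unfolding solves_omega_ode_def by metis
    then show "((\<lambda>x. of_real (x * exp (- ((1 + l)\<^sup>2 / x\<^sup>2))) * y x) has_vector_derivative of_real (omega_integrand l x)) (at x)"
      by (rule integrating_factor_forward)
    show "y x = of_real (exp ((1 + l)\<^sup>2 / x\<^sup>2) / x) * (of_real (x * exp (- ((1 + l)\<^sup>2 / x\<^sup>2))) * y x)"
      using \<open>x \<noteq> 0\<close> by (simp add: exp_minus field_simps)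
  qed
next
  assume ?R
  then obtain H where H: "\<And>x. x \<in> S \<Longrightarrow> (H has_vector_derivative of_real (omega_integrand l x)) (at x)"
    and y: "\<And>x. x \<in> S \<Longrightarrow> of_real (exp ((1 + l)\<^sup>2 / x\<^sup>2) / x) * H x = y x" by metis
  show ?L
    unfolding solves_omega_ode_def
  proof (intro ballI conjI)
    fix x assume x: "x \<in> S"
    then show x0: "x \<noteq> 0" using S(2) by metis
    from integrating_factor_backward[OF x0 H[OF x]] obtain y' where
      y': "((\<lambda>x. of_real (exp ((1 + l)\<^sup>2 / x\<^sup>2) / x) * H x) has_vector_derivative y') (at x)"
      "y' + of_real (1 / x + 2 * (1 + l)\<^sup>2 / x ^ 3) * (of_real (exp ((1 + l)\<^sup>2 / x\<^sup>2) / x) * H x) =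
       of_real (1 / x + 2 * l * (1 + l) / x ^ 3)" by blast
    have "(y has_vector_derivative y') (at x)"
      using has_vector_derivative_transform_within_open[OF y'(1) S(1) x y] .
    then show "\<exists>y'. (y has_vector_derivative y') (at x) \<and>
        y' + of_real (1 / x + 2 * (1 + l)\<^sup>2 / x ^ 3) * y x = of_real (1 / x + 2 * l * (1 + l) / x ^ 3)"
      using y'(2) unfolding y[OF x] by blast
  qed
qed

lemma has_vector_derivative_reflect:
  fixes f :: "real \<Rightarrow> 'a::real_normed_vector"
  assumes "(f has_vector_derivative f') (at (- x))"
  shows "((\<lambda>x. f (- x)) has_vector_derivative - f') (at x)"
proof -
  have "(uminus has_vector_derivative -1) (at x)"
    by (auto intro!: derivative_eq_intros)
  from vector_diff_chain_at[OF this, of f f'] assms show ?thesis by (simp add: o_def)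
qed

lemma solves_omega_ode_reflect:
  assumes "solves_omega_ode l y S"
  shows "solves_omega_ode l (\<lambda>x. y (- x)) {x. - x \<in> S}"
  unfolding solves_omega_ode_def
proof (intro ballI conjI)
  fix x assume "x \<in> {x. - x \<in> S}"
  then obtain y' where x: "- x \<noteq> 0" and y': "(y has_vector_derivative y') (at (- x))" and
    ode: "y' + of_real (1 / (- x) + 2 * (1 + l)\<^sup>2 / (- x) ^ 3) * y (- x) = of_real (1 / (- x) + 2 * l * (1 + l) / (- x) ^ 3)"
    using assms unfolding solves_omega_ode_def by blast
  show "x \<noteq> 0" using x by simp
  have neg: "1 / (- x) + p / (- x) ^ 3 = - (1 / x + p / x ^ 3)" for p
    by simp
  have "- y' + of_real (1 / x + 2 * (1 + l)\<^sup>2 / x ^ 3) * y (- x) = of_real (1 / x + 2 * l * (1 + l) / x ^ 3)"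
    using ode unfolding neg of_real_minus by algebra
  then show "\<exists>y'. ((\<lambda>x. y (- x)) has_vector_derivative y') (at x) \<and>
      y' + of_real (1 / x + 2 * (1 + l)\<^sup>2 / x ^ 3) * y (- x) = of_real (1 / x + 2 * l * (1 + l) / x ^ 3)"
    using has_vector_derivative_reflect[OF y'] by blast
qed

text \<open>The value \<open>y 0\<close> does not matter: the integrating factor vanishes at \<open>0\<close>, so every finite limit of \<open>y\<close> at
  \<open>0\<close> leads to the same function.\<close>

lemma omega_ode_unique_pos:
  fixes y :: "real \<Rightarrow> complex"
  assumes l: "l \<noteq> -1" and cont: "isCont y 0" and ode: "solves_omega_ode l y {0<..<r}" and x: "0 < x" "x < r"
  shows "y x = of_real (omega_formula l x)"
proof -
  let ?E = "\<lambda>x::real. x * exp (- ((1 + l)\<^sup>2 / x\<^sup>2))"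
  have E: "((\<lambda>x. ?E x) \<longlongrightarrow> 0) (at_right 0)"
  proof (rule Lim_null_comparison)
    show "\<forall>\<^sub>F x in at_right 0. norm (?E x) \<le> \<bar>x\<bar>"
      by (intro always_eventually) (auto simp: abs_mult intro: mult_left_le)
    show "((\<lambda>x::real. \<bar>x\<bar>) \<longlongrightarrow> 0) (at_right 0)"
      by (intro tendsto_rabs_zero tendsto_ident_at)
  qed
  have "of_real (?E x) * y x - of_real (omega_primitive l x) = 0"
  proof (rule zero_of_limit_0[where F = "\<lambda>x. of_real (?E x) * y x - of_real (omega_primitive l x)" and r = r])
    fix s assume s: "0 < s" "s < r"
    then obtain y' where y': "(y has_vector_derivative y') (at s)"
      "y' + of_real (1 / s + 2 * (1 + l)\<^sup>2 / s ^ 3) * y s = of_real (1 / s + 2 * l * (1 + l) / s ^ 3)"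
      using ode unfolding solves_omega_ode_def by force
    show "((\<lambda>x. of_real (?E x) * y x - of_real (omega_primitive l x)) has_vector_derivative 0) (at s)"
      using has_vector_derivative_diff[OF integrating_factor_forward[OF _ y']
          has_vector_derivative_of_real[OF omega_primitive_FTC(1)[OF l]]] s by simp
  next
    have "(y \<longlongrightarrow> y 0) (at_right 0)"
      using cont unfolding isCont_def by (rule filterlim_mono) (auto simp: at_le)
    from tendsto_diff[OF tendsto_mult[OF tendsto_of_real[OF E] this]
        tendsto_of_real[OF filterlim_mono[OF omega_primitive_FTC(2)[OF l] order_refl at_le[of "{0<..}" UNIV]]]]
    show "((\<lambda>x. of_real (?E x) * y x - of_real (omega_primitive l x)) \<longlongrightarrow> 0) (at_right 0)"
      by simp
  qed (use x in auto)
  then have "of_real (exp ((1 + l)\<^sup>2 / x\<^sup>2) / x) * (of_real (?E x) * y x) = of_real (omega_formula l x)"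
    by (simp add: omega_formula_eq)
  moreover have "exp ((1 + l)\<^sup>2 / x\<^sup>2) / x * ?E x = 1"
    using x by (simp add: exp_minus)
  then have "of_real (exp ((1 + l)\<^sup>2 / x\<^sup>2) / x) * (of_real (?E x) * y x) = y x"
    by (simp only: mult.assoc[symmetric] of_real_mult[symmetric]) simp
  ultimately show ?thesis by simp
qed

lemma omega_ode_unique:
  fixes y :: "real \<Rightarrow> complex"
  assumes l: "l \<noteq> -1" and cont: "isCont y 0" and ode: "solves_omega_ode l y ({- r<..<r} - {0})"
    and x: "x \<in> {- r<..<r} - {0}"
  shows "y x = of_real (omega_formula l x)"
proof (cases "0 < x")
  case True
  have "solves_omega_ode l y {0<..<r}"
    using ode unfolding solves_omega_ode_def by auto
  from omega_ode_unique_pos[OF l cont this] show ?thesis using True x by simp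
next
  case False
  have "solves_omega_ode l (\<lambda>x. y (- x)) {0<..<r}"
    using solves_omega_ode_reflect[OF ode] unfolding solves_omega_ode_def by auto
  moreover have "isCont (\<lambda>x. y (- x)) 0"
    using continuous_at_compose[of 0 uminus y] cont by (simp add: o_def)
  ultimately have "y (- (- x)) = of_real (omega_formula l (- x))"
    using False x by (intro omega_ode_unique_pos[OF l, of "\<lambda>x. y (- x)"]) auto
  then show ?thesis by (simp add: omega_formula_minus)
qed

lemma omega_eq_formula:
  assumes "l \<noteq> -1" "x \<noteq> 0"
  shows "omega (of_real l) x = of_real (omega_formula l x)"
proof (rule omega_ode_unique[OF assms(1) omega_isCont_0[OF assms(1)]])
  show "solves_omega_ode l (omega (of_real l)) ({- (\<bar>x\<bar> + 1)<..<\<bar>x\<bar> + 1} - {0})"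
    using omega_solves_ode[OF assms(1)] unfolding solves_omega_ode_def by auto
qed (use assms in auto)

text \<open>Both \<open>omega_primitive\<close> and the defect of the constant curve \<open>l\<close> have derivative \<open>omega_integrand\<close> on
  the positive axis and limit \<open>0\<close> at \<open>0\<close>.\<close>

lemma omega_formula_defect:
  assumes "-1 < l" "x \<noteq> 0"
  shows "omega_formula l x = exp ((1 + l)\<^sup>2 / x\<^sup>2) / \<bar>x\<bar> * defect \<bar>x\<bar> l"
proof -
  have pos: "omega_primitive l x = defect x l" if "0 < x" for x
  proof -
    have "defect x l - omega_primitive l x = 0"
    proof (rule zero_of_limit_0[where F = "\<lambda>x. defect x l - omega_primitive l x" and r = "x + 1"])
      fix s :: real assume s: "0 < s"
      have "((\<lambda>x. defect x l) has_real_derivative omega_integrand l s) (at s)"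
        by (rule DERIV_cong[OF defect_deriv[OF s DERIV_const[of l]]])
          (use s in \<open>simp add: omega_integrand_def zvar_real field_simps power2_eq_square\<close>)
      from DERIV_diff[OF this omega_primitive_FTC(1)[of l s]] s assms(1)
      show "((\<lambda>x. defect x l - omega_primitive l x) has_vector_derivative 0) (at s)"
        by (simp add: has_real_derivative_iff_has_vector_derivative)
    next
      have "l \<noteq> -1" using assms(1) by simp
      from tendsto_diff[OF defect_tendsto[OF tendsto_const assms(1)]
          filterlim_mono[OF omega_primitive_FTC(2)[OF this] order_refl at_le[of "{0<..}" UNIV]]]
      show "((\<lambda>x. defect x l - omega_primitive l x) \<longlongrightarrow> 0) (at_right 0)" by simp
    qed (use that in auto)
    then show ?thesis by simp
  qed
  show ?thesis
  proof (cases "0 < x")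
    case True
    then show ?thesis by (simp add: omega_formula_eq pos)
  next
    case False
    then have "omega_formula l (- x) = exp ((1 + l)\<^sup>2 / x\<^sup>2) / (- x) * defect (- x) l"
      using assms(2) by (simp add: omega_formula_eq pos)
    then show ?thesis using False by (simp add: omega_formula_minus)
  qed
qed

section \<open>The function \<open>\<lambda>\<^sup>*\<close>\<close>

lemma omega_zero_iff:
  assumes "-1 < l" "x \<noteq> 0"
  shows "omega (of_real l) x = 0 \<longleftrightarrow> defect \<bar>x\<bar> l = 0"
proof -
  have "l \<noteq> -1" using assms(1) by simp
  then have "omega (of_real l) x = of_real (exp ((1 + l)\<^sup>2 / x\<^sup>2) / \<bar>x\<bar> * defect \<bar>x\<bar> l)"
    by (simp only: omega_eq_formula[OF _ assms(2)] omega_formula_defect[OF assms] not_False_eq_True)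
  then show ?thesis using assms by (simp del: of_real_mult of_real_divide)
qed

lemma lambda_star_0: "lambda_star 0 = 0"
  unfolding lambda_star_def
proof (rule the_equality)
  show "-1 < (0::real) \<and> 0 \<le> (0::real) \<and> omega (complex_of_real 0) 0 = 0"
    using omega_0[of 0] by simp
  fix l :: real assume l: "-1 < l \<and> l \<le> 0 \<and> omega (complex_of_real l) 0 = 0"
  then have "1 - 1 / (1 + l) = 0" using omega_0[of l] by (simp del: of_real_diff of_real_divide)
  then show "l = 0" using l by (simp add: field_simps)
qed

lemma lambda_star_root:
  assumes "0 < \<bar>x\<bar>" "\<bar>x\<bar> < sqrt pi"
  shows "-1 < lambda_star x" "lambda_star x < 0" "defect \<bar>x\<bar> (lambda_star x) = 0"
proof -
  obtain l where l: "-1 < l" "l < 0" "defect \<bar>x\<bar> l = 0"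
    using defect_root[OF assms] .
  have "lambda_star x = l"
    unfolding lambda_star_def
  proof (rule the_equality)
    show "-1 < l \<and> l \<le> 0 \<and> omega (complex_of_real l) x = 0"
      using l assms omega_zero_iff[of l x] by auto
    fix k assume "-1 < k \<and> k \<le> 0 \<and> omega (complex_of_real k) x = 0"
    then show "k = l"
      using assms omega_zero_iff[of k x] defect_sign(3)[OF assms(1) l(3), of k] by auto
  qed
  with l show "-1 < lambda_star x" "lambda_star x < 0" "defect \<bar>x\<bar> (lambda_star x) = 0" by auto
qed

lemma lambda_star_eqI:
  assumes "0 < \<bar>x\<bar>" "\<bar>x\<bar> < sqrt pi" "defect \<bar>x\<bar> l = 0"
  shows "lambda_star x = l"
  using defect_sign(3)[OF assms(1) lambda_star_root(3)[OF assms(1,2)], of l] assms(3) by simp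

lemma lambda_star_minus:
  assumes "\<bar>x\<bar> < sqrt pi"
  shows "lambda_star (- x) = lambda_star x"
proof (cases "x = 0")
  case False
  then show ?thesis using assms lambda_star_root(3)[of x] by (intro lambda_star_eqI) auto
qed simp

lemma lambda_star_omega:
  assumes "\<bar>x\<bar> < sqrt pi"
  shows "-1 < lambda_star x" "omega (of_real (lambda_star x)) x = 0"
    "x \<noteq> 0 \<Longrightarrow> omega_formula (lambda_star x) x = 0"
proof -
  show l: "-1 < lambda_star x"
    using assms lambda_star_root(1)[of x] lambda_star_0 by (cases "x = 0") auto
  show o: "omega (of_real (lambda_star x)) x = 0"
  proof (cases "x = 0")
    case True
    then show ?thesis using omega_0[of 0] by (simp add: lambda_star_0)
  next
    case False
    then show ?thesis using omega_zero_iff[OF l False] lambda_star_root(3)[of x] assms by simp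
  qed
  show "omega_formula (lambda_star x) x = 0" if "x \<noteq> 0"
    using o omega_eq_formula[of "lambda_star x" x] l that by simp
qed

lemma lambda_star_implicit:
  assumes "\<bar>x\<bar> < sqrt pi"
  shows "implicit_formula (lambda_star x) x" "implicit_formula_erf (lambda_star x) x"
proof -
  have "implicit_formula (lambda_star x) x \<and> implicit_formula_erf (lambda_star x) x"
  proof (cases "x = 0")
    case True
    then show ?thesis by (simp add: lambda_star_0 implicit_formula_def implicit_formula_erf_def)
  next
    case False
    then show ?thesis
      using assms lambda_star_root(3)[of x]
      by (simp add: implicit_formula_iff_defect implicit_formula_erf_iff_defect)
  qed
  then show "implicit_formula (lambda_star x) x" "implicit_formula_erf (lambda_star x) x" by auto
qed

lemma lambda_star_deriv_pos:
  assumes x: "0 < x" "x < sqrt pi"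
  shows "(lambda_star has_real_derivative x / (2 * lambda_star x) + lambda_star x / x + 1 / x) (at x)"
proof -
  \<comment> \<open>In terms of \<open>z\<close>, the equation \<open>defect x l = 0\<close> reads \<open>x = m z\<close>, so \<open>g\<close> is a local inverse of \<open>m\<close>.\<close>
  define m where "m z = 2 * gauss_tail z * exp (z\<^sup>2)" for z
  define g where "g x = zvar (lambda_star x) x" for x
  have defect_m: "defect y l = 0 \<longleftrightarrow> m (zvar l y) = y" for y l
    by (auto simp: defect_def m_def exp_minus field_simps)
  have m_g: "m (g y) = y" if "0 < y" "y < sqrt pi" for y
    using lambda_star_root(3)[of y] that by (simp add: defect_m g_def)
  have g_m: "g (m z) = z" if "0 < m z" "m z < sqrt pi" for z
  proof -
    have z: "zvar (m z * z - 1) (m z) = z" using that by (simp add: zvar_real)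
    then have "defect \<bar>m z\<bar> (m z * z - 1) = 0" using that by (simp add: defect_m)
    then have "lambda_star (m z) = m z * z - 1" using that by (intro lambda_star_eqI) auto
    then show ?thesis using z by (simp add: g_def)
  qed
  have m_der: "(m has_real_derivative 2 * (z * m z - 1)) (at z)" for z
  proof -
    have "exp (- z\<^sup>2) * exp (z\<^sup>2) = 1" by (simp flip: exp_add)
    then show ?thesis unfolding m_def[abs_def]
      by (auto intro!: derivative_eq_intros simp: algebra_simps)
  qed
  have lam: "x * g x - 1 = lambda_star x" using x by (simp add: g_def zvar_real)
  have "isCont g (m (g x))"
  proof -
    have "((\<lambda>z. m z) \<longlongrightarrow> x) (nhds (g x))"
      using DERIV_isCont[OF m_der[of "g x"]] m_g[OF x] by (simp add: continuous_at_imp_continuous_on isCont_def tendsto_nhds_iff)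
    then have "\<forall>\<^sub>F z in nhds (g x). 0 < m z \<and> m z < sqrt pi"
      using x by (intro eventually_conj order_tendstoD)
    then obtain d where d: "0 < d" "\<And>z. dist z (g x) < d \<Longrightarrow> 0 < m z \<and> m z < sqrt pi"
      unfolding eventually_nhds_metric by blast
    show ?thesis
    proof (rule isCont_inverse_function[where f = m and g = g and x = "g x" and d = "d / 2"])
      fix z assume "\<bar>z - g x\<bar> \<le> d / 2"
      then show "g (m z) = z" using d by (intro g_m) (auto simp: dist_real_def)
      show "isCont m z" using m_der DERIV_isCont by blast
    qed (use d in simp)
  qed
  then have "isCont g x" using m_g[OF x] by simp
  then have "(g has_real_derivative inverse (2 * (g x * m (g x) - 1))) (at x)"
    using m_der[of "g x"] m_g x lambda_star_root(2)[of x] lam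
    by (intro DERIV_inverse_function[where f = m and a = 0 and b = "sqrt pi"]) (auto simp: mult.commute)
  then have "(g has_real_derivative 1 / (2 * lambda_star x)) (at x)"
    using m_g[OF x] lam by (simp add: mult.commute inverse_eq_divide)
  then have "((\<lambda>x. x * g x - 1) has_real_derivative g x + x * (1 / (2 * lambda_star x))) (at x)"
    by (auto intro!: derivative_eq_intros)
  then have "(lambda_star has_real_derivative g x + x * (1 / (2 * lambda_star x))) (at x)"
    by (rule DERIV_cong_ev[OF refl _ refl, THEN iffD1, rotated])
      (use x in \<open>intro eventually_nhds_in_open[of "{0<..}", THEN eventually_mono];
        auto simp: g_def zvar_real\<close>)
  then show ?thesis by (simp add: g_def zvar_def add_ac)
qed

lemma solves_lambda_ode_reflect:
  assumes "solves_lambda_ode f S"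
  shows "solves_lambda_ode (\<lambda>x. f (- x)) {x. - x \<in> S}"
  unfolding solves_lambda_ode_def
proof (intro ballI)
  fix x assume "x \<in> {x. - x \<in> S}"
  then have *: "- x \<noteq> 0" "f (- x) \<noteq> 0"
    "(f has_vector_derivative (of_real (- x) / (2 * f (- x)) + f (- x) / of_real (- x) + 1 / of_real (- x))) (at (- x))"
    using assms unfolding solves_lambda_ode_def by auto
  from has_vector_derivative_reflect[OF *(3)] *(1,2)
  show "x \<noteq> 0 \<and> f (- x) \<noteq> 0 \<and> ((\<lambda>x. f (- x)) has_vector_derivative
      (of_real x / (2 * f (- x)) + f (- x) / of_real x + 1 / of_real x)) (at x)"
    by (simp add: algebra_simps)
qed

lemma lambda_star_solves_ode: "solves_lambda_ode lambda_star ({- sqrt pi<..<sqrt pi} - {0})"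
  unfolding solves_lambda_ode_def
proof (intro ballI conjI)
  fix x assume x: "x \<in> {- sqrt pi<..<sqrt pi} - {0}"
  then show "x \<noteq> 0" "lambda_star x \<noteq> 0"
    using lambda_star_root(2)[of x] by (auto simp: abs_less_iff)
  have pos: "solves_lambda_ode lambda_star {0<..<sqrt pi}"
    unfolding solves_lambda_ode_def
  proof (intro ballI conjI)
    fix y assume y: "y \<in> {0<..<sqrt pi}"
    then show "y \<noteq> 0" "lambda_star y \<noteq> 0" using lambda_star_root(2)[of y] by auto
    show "(lambda_star has_vector_derivative (of_real y / (2 * lambda_star y) + lambda_star y / of_real y + 1 / of_real y)) (at y)"
      using lambda_star_deriv_pos[of y] y by (simp add: has_real_derivative_iff_has_vector_derivative)
  qed
  show "(lambda_star has_vector_derivative (of_real x / (2 * lambda_star x) + lambda_star x / of_real x + 1 / of_real x)) (at x)"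
  proof (cases "0 < x")
    case True
    with pos x show ?thesis by (simp add: solves_lambda_ode_def)
  next
    case False
    then have "((\<lambda>x. lambda_star (- x)) has_vector_derivative
        (of_real x / (2 * lambda_star (- x)) + lambda_star (- x) / of_real x + 1 / of_real x)) (at x)"
      using solves_lambda_ode_reflect[OF pos] x by (auto simp: solves_lambda_ode_def)
    then have "(lambda_star has_vector_derivative
        (of_real x / (2 * lambda_star (- x)) + lambda_star (- x) / of_real x + 1 / of_real x)) (at x)"
      by (rule has_vector_derivative_transform_within_open[where S = "{- sqrt pi<..<sqrt pi}"])
        (use x in \<open>auto intro!: lambda_star_minus\<close>)
    moreover have "lambda_star (- x) = lambda_star x"
      using x by (intro lambda_star_minus) auto
    ultimately show ?thesis by simp
  qed
qed

section \<open>The implicit solution and uniqueness among complex solutions\<close>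

lemma gauss_primitive_exists:
  "\<exists>G :: complex \<Rightarrow> complex. \<forall>z. (G has_field_derivative exp (- z\<^sup>2)) (at z)"
proof -
  have "(\<lambda>z. exp (- z\<^sup>2)) holomorphic_on (UNIV :: complex set)"
    by (intro holomorphic_intros)
  from holomorphic_convex_primitive'[OF convex_UNIV open_UNIV this]
  show ?thesis by (metis UNIV_I)
qed

text \<open>The complex counterpart of \<open>defect_deriv\<close>, with an entire primitive \<open>G\<close> in place of the tail.\<close>

lemma complex_first_integral_deriv:
  fixes f :: "real \<Rightarrow> complex"
  assumes x: "x \<noteq> 0" and f: "(f has_vector_derivative f') (at x)"
    and G: "\<And>z. (G has_field_derivative exp (- z\<^sup>2)) (at z)"
  shows "((\<lambda>x. exp (- (zvar (f x) x)\<^sup>2) * of_real x + 2 * G (zvar (f x) x)) has_vector_derivative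
    exp (- (zvar (f x) x)\<^sup>2) * (1 - 2 * (f' / of_real x - (f x + 1) / (of_real x)\<^sup>2) * f x)) (at x)"
proof -
  define Z where "Z x = zvar (f x) x" for x
  define Z' where "Z' = f' / of_real x - (f x + 1) / (of_real x)\<^sup>2"
  have "((\<lambda>x. 1 / x) has_real_derivative - 1 / x\<^sup>2) (at x)"
    using x by (auto intro!: derivative_eq_intros simp: power2_eq_square)
  from has_vector_derivative_mult[OF has_vector_derivative_add[OF f has_vector_derivative_const[of 1]] has_vector_derivative_of_real[OF this]]
  have Z: "(Z has_vector_derivative Z') (at x)"
    by (simp add: Z_def[abs_def] Z'_def zvar_def algebra_simps diff_divide_distrib add_divide_distrib)
  have "((\<lambda>z. exp (- z\<^sup>2)) has_field_derivative exp (- (Z x)\<^sup>2) * (- 2 * Z x)) (at (Z x))"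
    by (auto intro!: derivative_eq_intros)
  from field_vector_diff_chain_at[OF Z this]
  have "((\<lambda>x. exp (- (Z x)\<^sup>2)) has_vector_derivative Z' * (exp (- (Z x)\<^sup>2) * (- 2 * Z x))) (at x)"
    by (simp add: o_def)
  from has_vector_derivative_mult[OF this has_vector_derivative_of_real[OF DERIV_ident]]
  have E: "((\<lambda>x. exp (- (Z x)\<^sup>2) * of_real x) has_vector_derivative
      exp (- (Z x)\<^sup>2) + Z' * (exp (- (Z x)\<^sup>2) * (- 2 * Z x)) * of_real x) (at x)"
    by simp
  have "((\<lambda>x. 2 * G (Z x)) has_vector_derivative 2 * (Z' * exp (- (Z x)\<^sup>2))) (at x)"
    using field_vector_diff_chain_at[OF Z G] by (intro has_vector_derivative_mult_right) (simp add: o_def)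
  from has_vector_derivative_add[OF E this]
  have "((\<lambda>x. exp (- (Z x)\<^sup>2) * of_real x + 2 * G (Z x)) has_vector_derivative
      exp (- (Z x)\<^sup>2) + Z' * (exp (- (Z x)\<^sup>2) * (- 2 * Z x)) * of_real x + 2 * (Z' * exp (- (Z x)\<^sup>2))) (at x)" .
  moreover have "Z x * of_real x = f x + 1"
    using x by (simp add: Z_def zvar_def algebra_simps)
  then have "exp (- (Z x)\<^sup>2) + Z' * (exp (- (Z x)\<^sup>2) * (- 2 * Z x)) * of_real x + 2 * (Z' * exp (- (Z x)\<^sup>2)) =
      exp (- (Z x)\<^sup>2) * (1 - 2 * Z' * f x)"
    by algebra
  ultimately show ?thesis by (simp add: Z_def Z'_def)
qed

lemma lambda_ode_algebra:
  fixes y y' x :: complex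
  assumes "x \<noteq> 0" "y \<noteq> 0"
  shows "1 - 2 * (y' / x - (y + 1) / x\<^sup>2) * y = 0 \<longleftrightarrow> y' = x / (2 * y) + y / x + 1 / x"
proof -
  have "(1 - 2 * (y' / x - (y + 1) / x\<^sup>2) * y) * (x / (2 * y)) = x / (2 * y) + y / x + 1 / x - y'"
    using assms by (simp add: field_simps power2_eq_square)
  moreover have "x / (2 * y) \<noteq> 0" using assms by simp
  ultimately show ?thesis by (metis eq_iff_diff_eq_0 mult_eq_0_iff)
qed

lemma solves_lambda_ode_iff_implicit:
  fixes f :: "real \<Rightarrow> complex"
  assumes S: "open S" "is_interval S" "0 \<notin> S" and df: "f differentiable_on S" and nz: "\<forall>x\<in>S. f x \<noteq> 0"
  shows "solves_lambda_ode f S \<longleftrightarrow>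
        (\<exists>G :: complex \<Rightarrow> complex.
           (\<forall>z. (G has_field_derivative exp (- z\<^sup>2)) (at z)) \<and>
           (\<forall>x\<in>S. exp (- (zvar (f x) x)\<^sup>2) * of_real x = - 2 * G (zvar (f x) x)))" (is "?L \<longleftrightarrow> ?R")
proof
  assume ?L
  obtain G :: "complex \<Rightarrow> complex" where G: "\<And>z. (G has_field_derivative exp (- z\<^sup>2)) (at z)"
    using gauss_primitive_exists by metis
  let ?W = "\<lambda>x. exp (- (zvar (f x) x)\<^sup>2) * of_real x + 2 * G (zvar (f x) x)"
  have "(?W has_vector_derivative 0) (at x within S)" if x: "x \<in> S" for x
  proof -
    have x0: "x \<noteq> 0" and f0: "f x \<noteq> 0" and
      f': "(f has_vector_derivative (of_real x / (2 * f x) + f x / of_real x + 1 / of_real x)) (at x)"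
      using \<open>?L\<close> x unfolding solves_lambda_ode_def by auto
    have "1 - 2 * ((of_real x / (2 * f x) + f x / of_real x + 1 / of_real x) / of_real x - (f x + 1) / (of_real x)\<^sup>2) * f x = 0"
      by (rule iffD2[OF lambda_ode_algebra refl]) (use x0 f0 in simp_all)
    with complex_first_integral_deriv[OF x0 f' G] have "(?W has_vector_derivative 0) (at x)"
      by simp
    then show ?thesis by (rule has_vector_derivative_at_within)
  qed
  then obtain c where c: "\<And>x. x \<in> S \<Longrightarrow> ?W x = c"
    by (rule has_vector_derivative_zero_constant[where s = S and f = ?W, OF is_interval_convex[OF S(2)]])
      (assumption, rule that)
  show ?R
  proof (intro exI conjI allI ballI)
    show "((\<lambda>z. G z - c / 2) has_field_derivative exp (- z\<^sup>2)) (at z)" for z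
      using G[of z] by (auto intro!: derivative_eq_intros)
    show "exp (- (zvar (f x) x)\<^sup>2) * of_real x = - 2 * (G (zvar (f x) x) - c / 2)" if "x \<in> S" for x
      using c[OF that] by (simp add: algebra_simps eq_diff_eq)
  qed
next
  assume ?R
  then obtain G where G: "\<And>z. (G has_field_derivative exp (- z\<^sup>2)) (at z)"
    and eq: "\<And>x. x \<in> S \<Longrightarrow> exp (- (zvar (f x) x)\<^sup>2) * of_real x = - 2 * G (zvar (f x) x)" by blast
  show ?L
    unfolding solves_lambda_ode_def
  proof (intro ballI conjI)
    fix x assume x: "x \<in> S"
    then show x0: "x \<noteq> 0" and f0: "f x \<noteq> 0" using S(3) nz by auto
    have "f differentiable (at x)"
      using df S(1) x by (simp add: differentiable_on_eq_differentiable_at)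
    then obtain f' where f': "(f has_vector_derivative f') (at x)"
      using vector_derivative_works by blast
    note W = complex_first_integral_deriv[OF x0 f' G]
    have "((\<lambda>_. 0) has_vector_derivative
        exp (- (zvar (f x) x)\<^sup>2) * (1 - 2 * (f' / of_real x - (f x + 1) / (of_real x)\<^sup>2) * f x)) (at x)"
      by (rule has_vector_derivative_transform_within_open[OF W S(1) x]) (simp add: eq)
    from vector_derivative_unique_at[OF this has_vector_derivative_const]
    have "1 - 2 * (f' / of_real x - (f x + 1) / (of_real x)\<^sup>2) * f x = 0"
      by simp
    then have "f' = of_real x / (2 * f x) + f x / of_real x + 1 / of_real x"
      by (rule iffD1[OF lambda_ode_algebra, rotated 2]) (use x0 f0 in simp_all)
    with f' show "(f has_vector_derivative (of_real x / (2 * f x) + f x / of_real x + 1 / of_real x)) (at x)"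
      by simp
  qed
qed

lemma lambda_ode_Re_Im:
  fixes f :: "real \<Rightarrow> complex"
  assumes "solves_lambda_ode f S" "x \<in> S"
  defines "n \<equiv> (Re (f x))\<^sup>2 + (Im (f x))\<^sup>2"
  shows "0 < n"
    and "((\<lambda>x. Re (f x)) has_real_derivative x * Re (f x) / (2 * n) + Re (f x) / x + 1 / x) (at x)"
    and "((\<lambda>x. Im (f x)) has_real_derivative Im (f x) / x - x * Im (f x) / (2 * n)) (at x)"
proof -
  have f0: "f x \<noteq> 0" and x0: "x \<noteq> 0" and
    f': "(f has_vector_derivative (of_real x / (2 * f x) + f x / of_real x + 1 / of_real x)) (at x)"
    using assms(1,2) unfolding solves_lambda_ode_def by auto
  show "0 < n" using f0 unfolding n_def by (simp add: complex_eq_iff sum_power2_gt_zero_iff)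
  have d: "of_real x / (2 * f x) + f x / of_real x + 1 / of_real x =
    of_real (x / 2) * inverse (f x) + of_real (1 / x) * f x + of_real (1 / x)"
  proof -
    have "of_real x / (2 * f x) = of_real (x / 2) * inverse (f x)"
      by (simp add: field_simps)
    then show ?thesis by simp
  qed
  have re: "Re (of_real (x / 2) * inverse (f x) + of_real (1 / x) * f x + of_real (1 / x)) =
      x * Re (f x) / (2 * n) + Re (f x) / x + 1 / x"
    by (simp add: n_def)
  have im: "Im (of_real (x / 2) * inverse (f x) + of_real (1 / x) * f x + of_real (1 / x)) =
      Im (f x) / x - x * Im (f x) / (2 * n)"
    by (simp add: n_def)
  show "((\<lambda>x. Re (f x)) has_real_derivative x * Re (f x) / (2 * n) + Re (f x) / x + 1 / x) (at x)"
    using bounded_linear.has_vector_derivative[OF bounded_linear_Re f']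
    unfolding d re has_real_derivative_iff_has_vector_derivative .
  show "((\<lambda>x. Im (f x)) has_real_derivative Im (f x) / x - x * Im (f x) / (2 * n)) (at x)"
    using bounded_linear.has_vector_derivative[OF bounded_linear_Im f']
    unfolding d im has_real_derivative_iff_has_vector_derivative .
qed

text \<open>A nonzero imaginary part would force \<open>Re f\<close> to tend to minus infinity at \<open>0\<close>, at least logarithmically.\<close>

lemma lambda_ode_solution_real:
  fixes f :: "real \<Rightarrow> complex"
  assumes ode: "solves_lambda_ode f {0<..<r}" and lim: "(f \<longlongrightarrow> 0) (at_right 0)" and x0: "0 < x0" "x0 < r"
  shows "Im (f x0) = 0"
proof (rule ccontr)
  assume q0: "Im (f x0) \<noteq> 0"
  define n where "n x = (Re (f x))\<^sup>2 + (Im (f x))\<^sup>2" for x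
  have n: "0 < n x" and
    p: "((\<lambda>x. Re (f x)) has_real_derivative x * Re (f x) / (2 * n x) + Re (f x) / x + 1 / x) (at x)" and
    q: "((\<lambda>x. Im (f x)) has_real_derivative Im (f x) / x - x * Im (f x) / (2 * n x)) (at x)"
    if "0 < x" "x < r" for x
    using lambda_ode_Re_Im[OF ode, of x] that unfolding n_def by auto
  define d where "d = \<bar>Im (f x0)\<bar> / x0"
  have d: "0 < d" using q0 x0 by (simp add: d_def)
  \<comment> \<open>\<open>(Im f / x)\<^sup>2\<close> is nonincreasing, so \<open>\<bar>Im f\<bar>\<close> stays above \<open>d * x\<close> on the way down to \<open>0\<close>.\<close>
  have Im_lower: "d * x \<le> \<bar>Im (f x)\<bar>" if x: "0 < x" "x \<le> x0" for x
  proof -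
    have "(Im (f x0) / x0)\<^sup>2 \<le> (Im (f x) / x)\<^sup>2"
    proof (rule DERIV_nonpos_imp_nonincreasing[OF x(2)])
      fix y assume "x \<le> y" "y \<le> x0"
      then have y: "0 < y" "y < r" using x x0 by auto
      let ?q = "Im (f y)"
      have "((\<lambda>y. Im (f y) / y) has_real_derivative ((?q / y - y * ?q / (2 * n y)) * y - ?q) / (y * y)) (at y)"
        using DERIV_divide[OF q[OF y] DERIV_ident] y by simp
      moreover have "((?q / y - y * ?q / (2 * n y)) * y - ?q) / (y * y) = - (?q / (2 * n y))"
        using y n[OF y] by (simp add: field_simps)
      ultimately have "((\<lambda>y. Im (f y) / y) has_real_derivative - (?q / (2 * n y))) (at y)" by simp
      from DERIV_power[OF this, of 2]
      have "((\<lambda>y. (Im (f y) / y)\<^sup>2) has_real_derivative - (?q\<^sup>2 / (n y * y))) (at y)"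
        using y n[OF y] by (simp add: power2_eq_square)
      moreover have "- (?q\<^sup>2 / (n y * y)) \<le> 0" using y n[OF y] by simp
      ultimately show "\<exists>z. ((\<lambda>y. (Im (f y) / y)\<^sup>2) has_real_derivative z) (at y) \<and> z \<le> 0" by blast
    qed
    then have "\<bar>Im (f x0) / x0\<bar> \<le> \<bar>Im (f x) / x\<bar>" by (simp only: abs_le_square_iff)
    then have "d \<le> \<bar>Im (f x)\<bar> / x" using x x0 by (simp add: d_def abs_divide)
    then show ?thesis using x by (simp add: pos_le_divide_eq)
  qed
  have "((\<lambda>x. Re (f x)) \<longlongrightarrow> Re 0) (at_right 0)" by (intro tendsto_Re lim)
  then have "\<forall>\<^sub>F x in at_right 0. - 1 / 4 < Re (f x)" by (rule order_tendstoD) simp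
  then obtain b where b: "0 < b" "\<And>x. 0 < x \<Longrightarrow> x < b \<Longrightarrow> - 1 / 4 < Re (f x)"
    unfolding eventually_at_right_field by blast
  \<comment> \<open>Up to \<open>x1\<close>, the term \<open>x / (2 f)\<close> of the equation takes at most \<open>1 / (4 x)\<close> from the slope of \<open>Re f\<close>.\<close>
  define x1 where "x1 = min (b / 2) (min d x0)"
  have x1: "0 < x1" "x1 < b" "x1 \<le> d" "x1 \<le> x0" using b d x0 by (auto simp: x1_def)
  have slope: "1 / (2 * x) \<le> x * Re (f x) / (2 * n x) + Re (f x) / x + 1 / x" if x: "0 < x" "x \<le> x1" for x
  proof -
    let ?p = "Re (f x)" and ?q = "Im (f x)"
    have n0: "0 < n x" using n x x1 x0 by simp
    have "2 * (\<bar>?p\<bar> * (x * x)) \<le> 2 * (\<bar>?p\<bar> * \<bar>?q\<bar>)"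
    proof -
      have "x * x \<le> d * x" using x x1 by (intro mult_right_mono) auto
      also have "\<dots> \<le> \<bar>?q\<bar>" using Im_lower[of x] x x1 by simp
      finally show ?thesis by (intro mult_left_mono) auto
    qed
    also have "\<dots> \<le> n x" using sum_squares_bound[of "\<bar>?p\<bar>" "\<bar>?q\<bar>"] by (simp add: n_def)
    finally have "\<bar>?p\<bar> * (x * x) / n x \<le> 1 / 2"
      using n0 by (simp add: divide_le_eq)
    then have "- (?p * (x * x) / n x) \<le> 1 / 2"
      using n0 by (smt (verit) abs_ge_minus_self divide_right_mono less_imp_le minus_divide_left mult_minus_left mult_right_mono zero_le_square)
    moreover have "- 1 / 4 < ?p" using b(2)[of x] x x1 by simp
    moreover have "1 / 2 \<le> A / 2 + P + 1" if "- A \<le> 1 / 2" "- 1 / 4 < P" for A P :: real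
      using that by simp
    ultimately have "1 / 2 \<le> ?p * (x * x) / n x / 2 + ?p + 1" by blast
    then have "1 / 2 / x \<le> (?p * (x * x) / n x / 2 + ?p + 1) / x"
      using x by (intro divide_right_mono) auto
    also have "\<dots> = x * ?p / (2 * n x) + ?p / x + 1 / x"
      using x n0 by (simp add: field_simps)
    finally show ?thesis by simp
  qed
  have log: "Re (f x) - ln x / 2 \<le> Re (f x1) - ln x1 / 2" if x: "0 < x" "x \<le> x1" for x
  proof (rule DERIV_nonneg_imp_nondecreasing[OF x(2)])
    fix y assume "x \<le> y" "y \<le> x1"
    then have y: "0 < y" "y \<le> x1" "y < r" using x x1 x0 by auto
    have "((\<lambda>y. Re (f y) - ln y / 2) has_real_derivative
        (y * Re (f y) / (2 * n y) + Re (f y) / y + 1 / y) - 1 / (2 * y)) (at y)"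
      by (rule DERIV_diff[OF p[OF y(1,3)]]) (use y(1) in \<open>auto intro!: derivative_eq_intros\<close>)
    with slope[OF y(1,2)]
    show "\<exists>z. ((\<lambda>y. Re (f y) - ln y / 2) has_real_derivative z) (at y) \<and> 0 \<le> z" by force
  qed
  \<comment> \<open>The point at which the logarithmic bound pushes \<open>Re f\<close> down to \<open>-1\<close>.\<close>
  define x where "x = x1 * exp (- 2 * (Re (f x1) + 1))"
  have p1: "- 1 / 4 < Re (f x1)" using b(2) x1 by simp
  then have "x \<le> x1" using x1 by (simp add: x_def)
  moreover have "0 < x" using x1 by (simp add: x_def)
  moreover have "ln x / 2 = ln x1 / 2 - (Re (f x1) + 1)" using x1 by (simp add: x_def ln_mult field_simps)
  ultimately have "Re (f x) \<le> - 1" "- 1 / 4 < Re (f x)"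
    using log[of x] b(2)[of x] x1 by linarith+
  then show False by simp
qed

lemma lambda_ode_unique_pos:
  fixes f :: "real \<Rightarrow> complex"
  assumes ode: "solves_lambda_ode f {0<..<r}" and r: "r \<le> sqrt pi" and lim: "(f \<longlongrightarrow> 0) (at_right 0)"
    and x: "0 < x" "x < r"
  shows "f x = of_real (lambda_star x)"
proof -
  have Im0: "Im (f y) = 0" if "0 < y" "y < r" for y
    using lambda_ode_solution_real[OF ode lim that] .
  have "defect x (Re (f x)) = 0"
  proof (rule zero_of_limit_0[where r = r and F = "\<lambda>x. defect x (Re (f x))"])
    fix y assume y: "0 < y" "y < r"
    note D = lambda_ode_Re_Im[OF ode, of y]
    have u0: "Re (f y) \<noteq> 0" using D(1) y Im0[OF y] by auto
    have "((\<lambda>x. Re (f x)) has_real_derivative y / (2 * Re (f y)) + Re (f y) / y + 1 / y) (at y)"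
      using D(2) y Im0[OF y] u0 by (simp add: power2_eq_square)
    from defect_deriv[OF y(1) this]
    have "((\<lambda>x. defect x (Re (f x))) has_real_derivative 0) (at y)"
      by (rule DERIV_cong) (use u0 y in \<open>simp add: field_simps power2_eq_square\<close>)
    then show "((\<lambda>x. defect x (Re (f x))) has_vector_derivative 0) (at y)"
      by (simp add: has_real_derivative_iff_has_vector_derivative)
  next
    have "((\<lambda>x. Re (f x)) \<longlongrightarrow> Re 0) (at_right 0)" by (intro tendsto_Re lim)
    then show "((\<lambda>x. defect x (Re (f x))) \<longlongrightarrow> 0) (at_right 0)"
      by (intro defect_tendsto[where l = 0]) auto
  qed (use x in auto)
  then have "lambda_star x = Re (f x)" using x r by (intro lambda_star_eqI) auto
  then show ?thesis using Im0[OF x] by (simp add: complex_eq_iff)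
qed

lemma lambda_ode_unique:
  fixes f :: "real \<Rightarrow> complex"
  assumes r: "r \<le> sqrt pi" and f: "f 0 = 0" "isCont f 0"
    and ode: "solves_lambda_ode f ({- r<..<r} - {0})" and x: "x \<in> {- r<..<r}"
  shows "f x = of_real (lambda_star x)"
proof -
  have "isCont (\<lambda>x. f (- x)) 0"
    using continuous_at_compose[of 0 uminus f] f(2) by (simp add: o_def)
  then have lim: "(f \<longlongrightarrow> 0) (at_right 0)" "((\<lambda>x. f (- x)) \<longlongrightarrow> 0) (at_right 0)"
    using f unfolding isCont_def by (auto intro: filterlim_mono[OF _ order_refl at_le])
  consider "x = 0" | "0 < x" | "x < 0" by linarith
  then show ?thesis
  proof cases
    case 1
    then show ?thesis by (simp add: f lambda_star_0)
  next
    case 2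
    have "solves_lambda_ode f {0<..<r}" using ode unfolding solves_lambda_ode_def by auto
    from lambda_ode_unique_pos[OF this r lim(1)] 2 x show ?thesis by simp
  next
    case 3
    have "solves_lambda_ode (\<lambda>x. f (- x)) {0<..<r}"
      using solves_lambda_ode_reflect[OF ode] unfolding solves_lambda_ode_def by auto
    from lambda_ode_unique_pos[OF this r lim(2), of "- x"] 3 x
    have "f x = of_real (lambda_star (- x))" by simp
    moreover have "lambda_star (- x) = lambda_star x"
      using x r by (intro lambda_star_minus) auto
    ultimately show ?thesis by simp
  qed
qed

section \<open>The asymptotic series\<close>

text \<open>The coefficient of \<open>x^(2 n)\<close> in the formal power series solution; the constant term is \<open>0\<close>.\<close>

fun lambda_coeff :: "nat \<Rightarrow> real" where
  "lambda_coeff n = (if n = 0 then 0 else if n = 1 then - 1 / 2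
     else (\<Sum>r=1..n - 1. (2 * real r - 1) * lambda_coeff r * lambda_coeff (n - r)))"

declare lambda_coeff.simps [simp del]

lemma lambda_coeff_0 [simp]: "lambda_coeff 0 = 0" and lambda_coeff_1: "lambda_coeff 1 = - 1 / 2"
  and lambda_coeff_rec: "2 \<le> n \<Longrightarrow> lambda_coeff n = (\<Sum>r=1..n - 1. (2 * real r - 1) * lambda_coeff r * lambda_coeff (n - r))"
  by (simp_all add: lambda_coeff.simps)

text \<open>For \<open>u x = poly p (x\<^sup>2)\<close>, the residual \<open>x\<^sup>2 + 2 u + 2 u\<^sup>2 - 2 x u u'\<close> from \<open>defect_deriv\<close> as a
  polynomial in \<open>x\<^sup>2\<close>.\<close>

definition ode_residual :: "real poly \<Rightarrow> real poly" where
  "ode_residual p = [:0, 1:] + smult 2 p + smult 2 (p * p) - smult 4 (pCons 0 (pderiv p) * p)"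

lemma coeff_ode_residual:
  "coeff (ode_residual p) k = (if k = 1 then 1 else 0) + 2 * coeff p k
     - 2 * (\<Sum>i\<le>k. (2 * real i - 1) * coeff p i * coeff p (k - i))"
proof -
  have X: "coeff (pCons 0 (pderiv p)) i = real i * coeff p i" for i
    by (cases i) (simp_all add: coeff_pderiv)
  have id: "coeff [:0, 1 :: real:] k = (if k = 1 then 1 else 0)"
    by (auto simp: coeff_pCons split: nat.split)
  have "coeff (ode_residual p) k = (if k = 1 then 1 else 0) + 2 * coeff p k
      + 2 * (\<Sum>i\<le>k. coeff p i * coeff p (k - i)) - 4 * (\<Sum>i\<le>k. real i * coeff p i * coeff p (k - i))"
    by (simp only: ode_residual_def coeff_add coeff_diff coeff_smult coeff_mult X id)
  then show ?thesis
    by (simp add: sum_distrib_left algebra_simps sum_subtractf sum.distrib)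
qed

text \<open>The formal solution up to degree \<open>n\<close> in \<open>x\<^sup>2\<close>, with its last coefficient shifted by \<open>s\<close>.\<close>

definition trunc_poly :: "nat \<Rightarrow> real \<Rightarrow> real poly" where
  "trunc_poly n s = (\<Sum>j=1..n. monom (lambda_coeff j) j) + monom s n"

lemma coeff_trunc_poly:
  assumes "1 \<le> n" "k \<le> n"
  shows "coeff (trunc_poly n s) k = lambda_coeff k + (if k = n then s else 0)"
proof -
  have "(\<Sum>j=1..n. coeff (monom (lambda_coeff j) j) k) = (\<Sum>j=1..n. if j = k then lambda_coeff k else 0)"
    by (intro sum.cong) auto
  also have "\<dots> = lambda_coeff k" using assms by (cases "k = 0") auto
  finally show ?thesis by (simp add: trunc_poly_def coeff_sum)
qed

text \<open>The recursion cancels all residual coefficients up to degree \<open>n\<close> except for the effect of the shift. The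
  shift enters degree \<open>n\<close> linearly only, since the constant term is \<open>0\<close>.\<close>

lemma coeff_residual_trunc_poly:
  assumes n: "1 \<le> n" and k: "k \<le> n"
  shows "coeff (ode_residual (trunc_poly n s)) k = (if k = n then 2 * s else 0)"
proof -
  let ?c = "coeff (trunc_poly n s)"
  have c0: "?c 0 = 0" using coeff_trunc_poly[OF n, of 0 s] n by simp
  have "(\<Sum>i\<le>k. (2 * real i - 1) * ?c i * ?c (k - i)) = (\<Sum>r=1..k - 1. (2 * real r - 1) * ?c r * ?c (k - r))"
  proof (rule sum.mono_neutral_right)
    show "\<forall>i\<in>{..k} - {1..k - 1}. (2 * real i - 1) * ?c i * ?c (k - i) = 0"
    proof
      fix i assume "i \<in> {..k} - {1..k - 1}"
      then have "i = 0 \<or> i = k" by auto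
      then show "(2 * real i - 1) * ?c i * ?c (k - i) = 0" using c0 by auto
    qed
  qed auto
  also have "\<dots> = (\<Sum>r=1..k - 1. (2 * real r - 1) * lambda_coeff r * lambda_coeff (k - r))"
  proof (rule sum.cong[OF refl])
    fix r assume "r \<in> {1..k - 1}"
    then have "r \<le> n" "r \<noteq> n" "k - r \<le> n" "k - r \<noteq> n" using k by auto
    then show "(2 * real r - 1) * ?c r * ?c (k - r) = (2 * real r - 1) * lambda_coeff r * lambda_coeff (k - r)"
      by (simp add: coeff_trunc_poly[OF n])
  qed
  finally have sum: "(\<Sum>i\<le>k. (2 * real i - 1) * ?c i * ?c (k - i)) =
      (\<Sum>r=1..k - 1. (2 * real r - 1) * lambda_coeff r * lambda_coeff (k - r))" .
  consider "k = 0" | "k = 1" | "2 \<le> k" by linarith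
  then show ?thesis
  proof cases
    case 1
    then show ?thesis using n c0 by (simp add: coeff_ode_residual)
  next
    case 2
    then show ?thesis
      using n coeff_trunc_poly[OF n, of 1 s] unfolding coeff_ode_residual sum
      by (auto simp: lambda_coeff_1[simplified])
  next
    case 3
    then show ?thesis
      unfolding coeff_ode_residual sum using coeff_trunc_poly[OF n k, of s] lambda_coeff_rec[OF 3] by simp
  qed
qed

lemma poly_ode_residual:
  assumes "u = poly p (x\<^sup>2)" "u' = 2 * x * poly (pderiv p) (x\<^sup>2)"
  shows "poly (ode_residual p) (x\<^sup>2) = x\<^sup>2 + 2 * u + 2 * u\<^sup>2 - 2 * x * u * u'"
  by (simp add: assms ode_residual_def power2_eq_square algebra_simps)

text \<open>The residual starts with \<open>2 s x^(2 n)\<close>, so the defect of the shifted truncation has the sign of \<open>s\<close>.\<close>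

lemma defect_trunc_poly_sign:
  assumes n: "1 \<le> n" and s: "s \<noteq> 0"
  obtains d where "0 < d" "\<And>x. 0 < x \<Longrightarrow> x < d \<Longrightarrow> 0 \<le> s * defect x (poly (trunc_poly n s) (x\<^sup>2))"
proof -
  let ?p = "trunc_poly n s"
  have "monom 1 n dvd ode_residual ?p"
    unfolding monom_1_dvd_iff' using coeff_residual_trunc_poly[OF n] by simp
  then obtain q where q: "ode_residual ?p = monom 1 n * q" by (rule dvdE)
  have "coeff q 0 = 2 * s"
    using coeff_residual_trunc_poly[OF n order_refl, of s] unfolding q by (simp add: coeff_monom_mult)
  then have q0: "s * poly q (0\<^sup>2) = 2 * s\<^sup>2"
    by (simp add: poly_0_coeff_0 power2_eq_square)
  have "((\<lambda>x. s * poly q (x\<^sup>2)) \<longlongrightarrow> s * poly q (0\<^sup>2)) (at_right 0)"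
    by (intro tendsto_intros)
  moreover have "0 < s * poly q (0\<^sup>2)" unfolding q0 using s by simp
  ultimately have "\<forall>\<^sub>F x in at_right 0. 0 < s * poly q (x\<^sup>2)" by (rule order_tendstoD)
  then obtain d where d: "0 < d" "\<And>x. 0 < x \<Longrightarrow> x < d \<Longrightarrow> 0 < s * poly q (x\<^sup>2)"
    unfolding eventually_at_right_field by blast
  show ?thesis
  proof (rule that[OF d(1)])
    fix x assume x: "0 < x" "x < d"
    let ?u = "\<lambda>x. poly ?p (x\<^sup>2)"
    show "0 \<le> s * defect x (?u x)"
    proof (rule nonneg_of_limit_0[where r = d and F = "\<lambda>x. s * defect x (?u x)" and
          F' = "\<lambda>x. s * (exp (- (zvar (?u x) x)\<^sup>2) * poly (ode_residual ?p) (x\<^sup>2) / x\<^sup>2)"])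
      fix y assume y: "0 < y" "y < d"
      have "(?u has_real_derivative 2 * y * poly (pderiv ?p) (y\<^sup>2)) (at y)"
        by (auto intro!: derivative_eq_intros)
      from DERIV_cmult[OF defect_deriv[OF y(1) this], of s]
      show "((\<lambda>x. s * defect x (?u x)) has_real_derivative
          s * (exp (- (zvar (?u y) y)\<^sup>2) * poly (ode_residual ?p) (y\<^sup>2) / y\<^sup>2)) (at y)"
        unfolding poly_ode_residual[OF refl refl] .
      have "s * poly (ode_residual ?p) (y\<^sup>2) = (y\<^sup>2) ^ n * (s * poly q (y\<^sup>2))"
        unfolding q by (simp add: poly_monom)
      moreover have "0 \<le> (y\<^sup>2) ^ n * (s * poly q (y\<^sup>2))"
        by (rule mult_nonneg_nonneg) (use d(2)[OF y] in \<open>simp_all add: less_imp_le\<close>)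
      ultimately have "0 \<le> s * poly (ode_residual ?p) (y\<^sup>2)" by (simp only:)
      then have "0 \<le> exp (- (zvar (?u y) y)\<^sup>2) * (s * poly (ode_residual ?p) (y\<^sup>2)) / y\<^sup>2"
        by simp
      then show "0 \<le> s * (exp (- (zvar (?u y) y)\<^sup>2) * poly (ode_residual ?p) (y\<^sup>2) / y\<^sup>2)"
        by (simp only: mult_ac times_divide_eq_right)
    next
      have "(?u \<longlongrightarrow> poly ?p (0\<^sup>2)) (at_right 0)" by (intro tendsto_intros)
      moreover have "poly ?p (0\<^sup>2) = 0"
        using coeff_trunc_poly[OF n, of 0 s] n by (simp add: poly_0_coeff_0)
      ultimately have "((\<lambda>x. defect x (?u x)) \<longlongrightarrow> 0) (at_right 0)"
        by (intro defect_tendsto[where l = 0]) auto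
      then show "((\<lambda>x. s * defect x (?u x)) \<longlongrightarrow> 0) (at_right 0)"
        by (rule tendsto_mult_right_zero)
    qed (use x in auto)
  qed
qed

lemma poly_trunc_poly:
  "poly (trunc_poly n s) (x\<^sup>2) = (\<Sum>j=1..n. lambda_coeff j * x ^ (2 * j)) + s * x ^ (2 * n)"
  by (simp add: trunc_poly_def poly_sum poly_monom power_mult)

text \<open>The truncations shifted by \<open>1\<close> and \<open>-1\<close> bound \<open>\<lambda>\<^sup>*\<close> from above and below.\<close>

lemma lambda_star_expansion:
  "\<exists>d>0. \<forall>x. \<bar>x\<bar> < d \<longrightarrow> \<bar>lambda_star x - (\<Sum>j=1..N. lambda_coeff j * x ^ (2 * j))\<bar> \<le> (\<bar>lambda_coeff (Suc N)\<bar> + 1) * x ^ (2 * N + 2)"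
proof -
  let ?n = "Suc N" and ?S = "\<lambda>x::real. \<Sum>j=1..N. lambda_coeff j * x ^ (2 * j)"
  obtain d1 where d1: "0 < d1" "\<And>x. 0 < x \<Longrightarrow> x < d1 \<Longrightarrow> 0 \<le> 1 * defect x (poly (trunc_poly ?n 1) (x\<^sup>2))"
    by (rule defect_trunc_poly_sign[of ?n 1]) auto
  obtain d2 where d2: "0 < d2" "\<And>x. 0 < x \<Longrightarrow> x < d2 \<Longrightarrow> 0 \<le> (- 1) * defect x (poly (trunc_poly ?n (- 1)) (x\<^sup>2))"
    by (rule defect_trunc_poly_sign[of ?n "- 1"]) auto
  define d where "d = min (sqrt pi) (min d1 d2)"
  have pos: "\<bar>lambda_star x - ?S x\<bar> \<le> (\<bar>lambda_coeff ?n\<bar> + 1) * x ^ (2 * N + 2)" if x: "0 < x" "x < d" for x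
  proof -
    have l: "0 < \<bar>x\<bar>" "\<bar>x\<bar> < sqrt pi" using x by (auto simp: d_def)
    have root: "defect x (lambda_star x) = 0" using lambda_star_root(3)[OF l] x by simp
    have p: "poly (trunc_poly ?n s) (x\<^sup>2) = ?S x + (lambda_coeff ?n + s) * x ^ (2 * N + 2)" for s
      unfolding poly_trunc_poly by (simp add: algebra_simps)
    have "lambda_star x \<le> ?S x + (lambda_coeff ?n + 1) * x ^ (2 * N + 2)"
      using d1(2)[of x] x defect_sign(1)[OF x(1) root] unfolding p by (simp add: d_def)
    moreover have "?S x + (lambda_coeff ?n + - 1) * x ^ (2 * N + 2) \<le> lambda_star x"
      using d2(2)[of x] x defect_sign(2)[OF x(1) root] unfolding p by (simp add: d_def)
    moreover have "(lambda_coeff ?n + 1) * x ^ (2 * N + 2) \<le> (\<bar>lambda_coeff ?n\<bar> + 1) * x ^ (2 * N + 2)"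
      "- ((lambda_coeff ?n + - 1) * x ^ (2 * N + 2)) \<le> (\<bar>lambda_coeff ?n\<bar> + 1) * x ^ (2 * N + 2)"
      using x unfolding minus_mult_left by (intro mult_right_mono; simp)+
    ultimately show ?thesis by (simp only: abs_le_iff) linarith
  qed
  show ?thesis
  proof (intro exI[of _ d] conjI allI impI)
    show "0 < d" using d1 d2 by (simp add: d_def)
    fix x assume x: "\<bar>x\<bar> < d"
    consider "x = 0" | "0 < x" | "x < 0" by linarith
    then show "\<bar>lambda_star x - ?S x\<bar> \<le> (\<bar>lambda_coeff ?n\<bar> + 1) * x ^ (2 * N + 2)"
    proof cases
      case 1
      moreover have "?S 0 = 0" by (intro sum.neutral) auto
      ultimately show ?thesis by (simp add: lambda_star_0)
    next
      case 2
      then show ?thesis using pos x by simp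
    next
      case 3
      have "lambda_star (- x) = lambda_star x"
        using x by (intro lambda_star_minus) (simp add: d_def)
      then show ?thesis using pos[of "- x"] 3 x by simp
    qed
  qed
qed

lemma lambda_star_even_series: "even_series_near_0 lambda_star (\<lambda>m. lambda_coeff (m div 2))"
  unfolding even_series_near_0_def
proof
  fix N
  obtain d where "0 < d" and d: "\<And>x. \<bar>x\<bar> < d \<Longrightarrow>
    \<bar>lambda_star x - (\<Sum>j=1..N. lambda_coeff j * x ^ (2 * j))\<bar> \<le> (\<bar>lambda_coeff (Suc N)\<bar> + 1) * x ^ (2 * N + 2)"
    using lambda_star_expansion by blast
  show "(\<lambda>x. lambda_star x - (\<Sum>j=1..N. lambda_coeff (2 * j div 2) * x ^ (2 * j))) \<in> O[at 0](\<lambda>x. x ^ (2 * N + 2))"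
  proof (rule bigoI)
    have even: "0 \<le> x ^ (2 * N + 2)" for x :: real
      by (intro zero_le_even_power) simp
    have "norm (lambda_star x - (\<Sum>j=1..N. lambda_coeff (2 * j div 2) * x ^ (2 * j)))
      \<le> (\<bar>lambda_coeff (Suc N)\<bar> + 1) * norm (x ^ (2 * N + 2))" if "\<bar>x\<bar> < d" for x
      using d[OF that] by (simp only: real_norm_def abs_of_nonneg[OF even] nonzero_mult_div_cancel_left[OF zero_neq_numeral[symmetric]])
    then show "\<forall>\<^sub>F x in at 0. norm (lambda_star x - (\<Sum>j=1..N. lambda_coeff (2 * j div 2) * x ^ (2 * j)))
      \<le> (\<bar>lambda_coeff (Suc N)\<bar> + 1) * norm (x ^ (2 * N + 2))"
      using \<open>0 < d\<close> unfolding eventually_at by (auto simp: dist_real_def)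
  qed
qed

lemma lambda_star_isCont_0: "isCont lambda_star 0"
proof -
  obtain d where "0 < d" and "\<forall>x. \<bar>x\<bar> < d \<longrightarrow>
      \<bar>lambda_star x - (\<Sum>j=1..0. lambda_coeff j * x ^ (2 * j))\<bar> \<le> (\<bar>lambda_coeff (Suc 0)\<bar> + 1) * x ^ (2 * 0 + 2)"
    using lambda_star_expansion[of 0] by blast
  then have d: "\<bar>lambda_star x\<bar> \<le> (\<bar>lambda_coeff (Suc 0)\<bar> + 1) * x\<^sup>2" if "\<bar>x\<bar> < d" for x
    using that by (simp add: numeral_2_eq_2)
  have "(lambda_star \<longlongrightarrow> 0) (at 0)"
  proof (rule Lim_null_comparison)
    show "\<forall>\<^sub>F x in at 0. norm (lambda_star x) \<le> (\<bar>lambda_coeff (Suc 0)\<bar> + 1) * x\<^sup>2"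
      using \<open>0 < d\<close> d unfolding eventually_at by (auto simp: dist_real_def)
    show "((\<lambda>x. (\<bar>lambda_coeff (Suc 0)\<bar> + 1) * x\<^sup>2) \<longlongrightarrow> 0) (at 0)"
      by (auto intro!: tendsto_eq_intros)
  qed
  then show ?thesis by (simp add: isCont_def lambda_star_0)
qed

section \<open>The dispersion relation and its zero curve\<close>

theorem propositionA1:
  shows
  "(
    solves_lambda_ode lambda_star ({- sqrt pi <..< sqrt pi} - {0}) \<and>
    (\<forall>(f :: real \<Rightarrow> complex) S.
       open S \<and> is_interval S \<and> 0 \<notin> S \<and> f differentiable_on S \<and> (\<forall>x\<in>S. f x \<noteq> 0) \<longrightarrow>
       (solves_lambda_ode f S \<longleftrightarrow>
        (\<exists>G :: complex \<Rightarrow> complex.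
           (\<forall>z. (G has_field_derivative exp (- z\<^sup>2)) (at z)) \<and>
           (\<forall>x\<in>S. exp (- (zvar (f x) x)\<^sup>2) * of_real x = - 2 * G (zvar (f x) x))))) \<and>
    lambda_star 0 = 0 \<and> isCont lambda_star 0 \<and>
    (\<forall>r (f :: real \<Rightarrow> complex).
       0 < r \<and> r \<le> sqrt pi \<and> f 0 = 0 \<and> isCont f 0 \<and> solves_lambda_ode f ({- r <..< r} - {0}) \<longrightarrow>
       (\<forall>x\<in>{- r <..< r}.
          f x \<in> \<real> \<and> f x = of_real (lambda_star x) \<and>
          implicit_formula (Re (f x)) x \<and> implicit_formula_erf (Re (f x)) x)) \<and>
    (\<forall>x\<in>{- sqrt pi <..< sqrt pi}.
       implicit_formula (lambda_star x) x \<and> implicit_formula_erf (lambda_star x) x) \<and>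
    (\<exists>a :: nat \<Rightarrow> real.
       a 2 = - 1 / 2 \<and>
       (\<forall>j\<ge>2. a (2*j) = (\<Sum>r=1..j-1. (2 * real r - 1) * a (2*r) * a (2*(j-r)))) \<and>
       even_series_near_0 lambda_star a)
   ) \<and>
   (
    \<forall>s\<in>{1, -1 :: real}.
      (\<exists>(P :: real \<Rightarrow> real \<Rightarrow> complex) (Q :: real \<Rightarrow> real \<Rightarrow> complex).
         \<forall>l t. l \<noteq> -1 \<and> 0 \<le> t \<longrightarrow>
           ((\<lambda>k. omega (of_real k) (s * sqrt t)) has_vector_derivative P l t) (at l) \<and>
           ((\<lambda>k. P k t) has_vector_derivative Q l t) (at l) \<and>
           ((\<lambda>u. omega (of_real l) (s * sqrt u)) has_vector_derivative - (1 / 4) * Q l t)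
             (at t within {0..})) \<and>
      (\<forall>l>-1. omega (of_real l) (s * sqrt 0) = of_real (1 - 1 / (1 + l)))
   ) \<and>
   (
    (\<forall>l. l \<noteq> -1 \<longrightarrow>
      (\<forall>x. omega (of_real l) x =
         of_real (1 - (LBINT v. (1 + l) * w v / ((1 + l)\<^sup>2 + (v * x)\<^sup>2)))) \<and>
      solves_omega_ode l (omega (of_real l)) (- {0}) \<and>
      (\<forall>(y :: real \<Rightarrow> complex) S.
         open S \<and> is_interval S \<and> 0 \<notin> S \<longrightarrow>
         (solves_omega_ode l y S \<longleftrightarrow>
          (\<exists>H :: real \<Rightarrow> complex.
             \<forall>x\<in>S. (H has_vector_derivative of_real (omega_integrand l x)) (at x) \<and>
                   y x = of_real (exp ((1 + l)\<^sup>2 / x\<^sup>2) / x) * H x)))) \<and>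
    (\<forall>l>-1.
      omega (of_real l) 0 = of_real (1 - 1 / (1 + l)) \<and> isCont (omega (of_real l)) 0 \<and>
      (\<forall>x. x \<noteq> 0 \<longrightarrow> omega (of_real l) x = of_real (omega_formula l x)) \<and>
      (\<forall>r>0. \<forall>y :: real \<Rightarrow> complex.
         y 0 = of_real (1 - 1 / (1 + l)) \<and> isCont y 0 \<and>
         solves_omega_ode l y ({- r <..< r} - {0}) \<longrightarrow>
         (\<forall>x\<in>{- r <..< r} - {0}. y x = of_real (omega_formula l x))) \<and>
      (\<forall>x. x \<noteq> 0 \<and> omega_formula l x = 0 \<longrightarrow>
         implicit_formula l x \<and> implicit_formula_erf l x)) \<and>
    (\<forall>x\<in>{- sqrt pi <..< sqrt pi}.
       -1 < lambda_star x \<and> omega (of_real (lambda_star x)) x = 0 \<and>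
       (x \<noteq> 0 \<longrightarrow> omega_formula (lambda_star x) x = 0))
   )"
proof (intro conjI)
  show "solves_lambda_ode lambda_star ({- sqrt pi <..< sqrt pi} - {0})"
    by (rule lambda_star_solves_ode)
  show "\<forall>(f :: real \<Rightarrow> complex) S.
       open S \<and> is_interval S \<and> 0 \<notin> S \<and> f differentiable_on S \<and> (\<forall>x\<in>S. f x \<noteq> 0) \<longrightarrow>
       (solves_lambda_ode f S \<longleftrightarrow>
        (\<exists>G :: complex \<Rightarrow> complex.
           (\<forall>z. (G has_field_derivative exp (- z\<^sup>2)) (at z)) \<and>
           (\<forall>x\<in>S. exp (- (zvar (f x) x)\<^sup>2) * of_real x = - 2 * G (zvar (f x) x))))"
    by (intro allI impI solves_lambda_ode_iff_implicit) auto
  show "lambda_star 0 = 0" by (rule lambda_star_0)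
  show "isCont lambda_star 0" by (rule lambda_star_isCont_0)
  show "\<forall>r (f :: real \<Rightarrow> complex).
       0 < r \<and> r \<le> sqrt pi \<and> f 0 = 0 \<and> isCont f 0 \<and> solves_lambda_ode f ({- r <..< r} - {0}) \<longrightarrow>
       (\<forall>x\<in>{- r <..< r}.
          f x \<in> \<real> \<and> f x = of_real (lambda_star x) \<and>
          implicit_formula (Re (f x)) x \<and> implicit_formula_erf (Re (f x)) x)"
  proof (intro allI impI ballI)
    fix r x and f :: "real \<Rightarrow> complex"
    assume f: "0 < r \<and> r \<le> sqrt pi \<and> f 0 = 0 \<and> isCont f 0 \<and> solves_lambda_ode f ({- r <..< r} - {0})"
      and x: "x \<in> {- r <..< r}"
    then have eq: "f x = of_real (lambda_star x)"
      by (intro lambda_ode_unique[of r]) auto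
    have "\<bar>x\<bar> < sqrt pi" using f x by auto
    with eq show "f x \<in> \<real> \<and> f x = of_real (lambda_star x) \<and>
        implicit_formula (Re (f x)) x \<and> implicit_formula_erf (Re (f x)) x"
      by (simp add: lambda_star_implicit)
  qed
  show "\<forall>x\<in>{- sqrt pi <..< sqrt pi}.
       implicit_formula (lambda_star x) x \<and> implicit_formula_erf (lambda_star x) x"
    by (auto intro!: lambda_star_implicit simp: abs_less_iff)
  show "\<exists>a :: nat \<Rightarrow> real.
       a 2 = - 1 / 2 \<and>
       (\<forall>j\<ge>2. a (2*j) = (\<Sum>r=1..j-1. (2 * real r - 1) * a (2*r) * a (2*(j-r)))) \<and>
       even_series_near_0 lambda_star a"
  proof (intro exI[of _ "\<lambda>m. lambda_coeff (m div 2)"] conjI allI impI)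
    show "lambda_coeff (2 div 2) = - 1 / 2" using lambda_coeff_1 by simp
    show "even_series_near_0 lambda_star (\<lambda>m. lambda_coeff (m div 2))"
      by (rule lambda_star_even_series)
    fix j :: nat assume "2 \<le> j"
    then show "lambda_coeff (2 * j div 2) =
        (\<Sum>r=1..j-1. (2 * real r - 1) * lambda_coeff (2 * r div 2) * lambda_coeff (2 * (j - r) div 2))"
      by (simp only: lambda_coeff_rec nonzero_mult_div_cancel_left[of 2] numeral_neq_zero not_False_eq_True)
  qed
next
  show "\<forall>s\<in>{1, -1 :: real}.
      (\<exists>(P :: real \<Rightarrow> real \<Rightarrow> complex) (Q :: real \<Rightarrow> real \<Rightarrow> complex).
         \<forall>l t. l \<noteq> -1 \<and> 0 \<le> t \<longrightarrow>
           ((\<lambda>k. omega (of_real k) (s * sqrt t)) has_vector_derivative P l t) (at l) \<and>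
           ((\<lambda>k. P k t) has_vector_derivative Q l t) (at l) \<and>
           ((\<lambda>u. omega (of_real l) (s * sqrt u)) has_vector_derivative - (1 / 4) * Q l t)
             (at t within {0..})) \<and>
      (\<forall>l>-1. omega (of_real l) (s * sqrt 0) = of_real (1 - 1 / (1 + l)))"
  proof (intro ballI conjI allI impI)
    fix s l :: real assume "-1 < l"
    then show "omega (of_real l) (s * sqrt 0) = of_real (1 - 1 / (1 + l))"
      using omega_0[of l] by simp
  qed (rule omega_heat_equation, auto)
next
  show "\<forall>l. l \<noteq> -1 \<longrightarrow>
      (\<forall>x. omega (of_real l) x =
         of_real (1 - (LBINT v. (1 + l) * w v / ((1 + l)\<^sup>2 + (v * x)\<^sup>2)))) \<and>
      solves_omega_ode l (omega (of_real l)) (- {0}) \<and>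
      (\<forall>(y :: real \<Rightarrow> complex) S.
         open S \<and> is_interval S \<and> 0 \<notin> S \<longrightarrow>
         (solves_omega_ode l y S \<longleftrightarrow>
          (\<exists>H :: real \<Rightarrow> complex.
             \<forall>x\<in>S. (H has_vector_derivative of_real (omega_integrand l x)) (at x) \<and>
                   y x = of_real (exp ((1 + l)\<^sup>2 / x\<^sup>2) / x) * H x)))"
    by (intro allI impI conjI solves_omega_ode_iff omega_solves_ode)
      (auto simp: omega_eq_kappa kappa_eq_integral)
  show "\<forall>l>-1.
      omega (of_real l) 0 = of_real (1 - 1 / (1 + l)) \<and> isCont (omega (of_real l)) 0 \<and>
      (\<forall>x. x \<noteq> 0 \<longrightarrow> omega (of_real l) x = of_real (omega_formula l x)) \<and>
      (\<forall>r>0. \<forall>y :: real \<Rightarrow> complex.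
         y 0 = of_real (1 - 1 / (1 + l)) \<and> isCont y 0 \<and>
         solves_omega_ode l y ({- r <..< r} - {0}) \<longrightarrow>
         (\<forall>x\<in>{- r <..< r} - {0}. y x = of_real (omega_formula l x))) \<and>
      (\<forall>x. x \<noteq> 0 \<and> omega_formula l x = 0 \<longrightarrow>
         implicit_formula l x \<and> implicit_formula_erf l x)"
  proof (intro allI impI conjI ballI)
    fix l :: real assume l: "-1 < l"
    then have l1: "l \<noteq> -1" by simp
    show "omega (of_real l) 0 = of_real (1 - 1 / (1 + l))" by (rule omega_0[OF l1])
    show "isCont (omega (of_real l)) 0" by (rule omega_isCont_0[OF l1])
    show "omega (of_real l) x = of_real (omega_formula l x)" if "x \<noteq> 0" for x
      by (rule omega_eq_formula[OF l1 that])
    show "y x = of_real (omega_formula l x)"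
      if "y 0 = of_real (1 - 1 / (1 + l)) \<and> isCont y 0 \<and> solves_omega_ode l y ({- r <..< r} - {0})"
        and "x \<in> {- r <..< r} - {0}" for r x and y :: "real \<Rightarrow> complex"
      by (rule omega_ode_unique[OF l1 _ _ that(2)]) (use that(1) in auto)
    fix x assume x: "x \<noteq> 0 \<and> omega_formula l x = 0"
    then have "defect \<bar>x\<bar> l = 0" using omega_formula_defect[OF l, of x] by auto
    with x show "implicit_formula l x" "implicit_formula_erf l x"
      by (simp_all add: implicit_formula_iff_defect implicit_formula_erf_iff_defect)
  qed
  show "\<forall>x\<in>{- sqrt pi <..< sqrt pi}.
       -1 < lambda_star x \<and> omega (of_real (lambda_star x)) x = 0 \<and>
       (x \<noteq> 0 \<longrightarrow> omega_formula (lambda_star x) x = 0)"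
    by (intro ballI conjI impI lambda_star_omega) (auto simp: abs_less_iff)
qed

end
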